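(* Let the optimal control problem associated with the tuple $\{c,g,f,U,T\}$ be of class $L$, with value function $V^*$. Then for any admissible candidate value function $J$ with associated admissible controller $\pi_J$, and any $x_0\in\mathbb{R}^n$, $$L(u_{\pi_J,x_0},x_0)\le 2T\delta_1+2\delta_2,$$ where $$\delta_1=\operatorname*{ess\,sup}_{x\in B_R(0),\,t\in[0,T]}\left|\frac{\partial}{\partial t}J(t,x)+\inf_{u\in U}H(t,x,u,\nabla_xJ(t,x))\right|,\qquad \delta_2=\operatorname*{ess\,sup}_{x\in B_R(0)}|J(T,x)-g(x)|,$$ $H(t,x,u,q):=c(t,x,u)+q^\top f(t,x,u)$, $R:=(1+\|x_0\|_2)e^{\beta_fT}-1$, $\beta_f>0$ is the linear growth constant of $f$ from the definition of class $L$, and $L$ is the optimality gap $$L(u,x_0):=\int_0^T c(s,x_{u,x_0}(s),u(s))\,ds+g(x_{u,x_0}(T))-V^*(0,x_0).$$ (The derivatives of $J$ in $\delta_1$ exist almost everywhere because $J$ is Lipschitz.)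
   Context: **Optimal control problem (OCP).** Data: $c:\mathbb{R}\times\mathbb{R}^n\times\mathbb{R}^m\to\mathbb{R}$, $g:\mathbb{R}^n\to\mathbb{R}$, $f:\mathbb{R}\times\mathbb{R}^n\times\mathbb{R}^m\to\mathbb{R}^n$, $U\subset\mathbb{R}^m$, $T>0$. For $(t_0,x_0)\in[0,T]\times\mathbb{R}^n$ an admissible input is a measurable $u:[t_0,T]\to\mathbb{R}^m$ with $u(t)\in U$ for all $t\in[t_0,T]$. The value function is $$V^*(t_0,x_0):=\inf_u\int_{t_0}^T c(t,x(t),u(t))\,dt+g(x(T)),$$ the infimum being over admissible inputs, where $x$ is the solution of $\dot x(t)=f(t,x(t),u(t))$ on $[t_0,T]$, $x(t_0)=x_0$. **Class $L$.** The OCP is of class $L$ if: (1) $U$ is compact; (2) $f,c,g$ are uniformly Lipschitz continuous in the state variable and uniformly continuous in the time and input variables (where they depend on these); specifically there are $\alpha_f,\alpha_c,\alpha_g>0$ with $\|f(t,x,u)-f(t,y,u)\|_2\le\alpha_f\|x-y\|_2$, $|c(t,x,u)-c(t,y,u)|\le\alpha_c\|x-y\|_2$, $|g(x)-g(y)|\le\alpha_g\|x-y\|_2$ for all $x,y\in\mathbb{R}^n$, $t\in[0,T]$, $u\in U$; (3) there are $\beta_f,\beta_c,\beta_g>0$ with $\|f(t,x,u)\|_2\le\beta_f(1+\|x\|_2)$, $|c(t,x,u)|\le\beta_c(1+\|x\|_2)$, $|g(x)|\le\beta_g(1+\|x\|_2)$ for all $x\in\mathbb{R}^n$, $t\in[0,T]$,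 $u\in U$. For class $L$ problems and any admissible input $u:[0,T]\to U$ there is a unique absolutely continuous solution with $t_0=0$, denoted $x_{u,x_0}$. **Admissible controller.** A measurable function $\pi(t,x)$ such that for every $(t_0,x_0)\in[0,T]\times\mathbb{R}^n$ the problem $\dot x(t)=f(t,x(t),\pi(t,x(t)))$, $x(t_0)=x_0$, has a unique solution and $\pi(t,x(t))\in U$ for all $t\in[t_0,T]$. For $t_0=0$, the corresponding admissible input is $u_{\pi,x_0}(t):=\pi(t,x(t))$. **Differentials.** For continuous $u:\Omega\to\mathbb{R}$, $\Omega\subset\mathbb{R}^N$, $x\in\Omega$: $D^+u(x)$ is the set of $p\in\mathbb{R}^N$ with $\limsup_{y\to x,\,y\in\Omega}\frac{u(y)-u(x)-p^\top(y-x)}{|y-x|}\le0$; $D^-u(x)$ is the set of $p\in\mathbb{R}^N$ with $\liminf_{y\to x,\,y\in\Omega}\frac{u(y)-u(x)-p^\top(y-x)}{|y-x|}\ge0$; $D^\pm u(x):=D^+u(x)\cup D^-u(x)$. For Lipschitz $u$, the Clarke generalized gradient $\partial_Cu(x)$ is the set of $p\in\mathbb{R}^N$ with $p^\top v\le\limsup_{y\to x,\,h\downarrow0}\frac{u(y+hv)-u(y)}{h}$ for all $v\in\mathbb{R}^N$. For a function $J(t,x)$ of time and state, elements are written $(p,q)$ with $p\in\mathbb{R}$ the time component and $q\in\mathbb{R}^n$ the spatial component. **Admissible candidate value function.** With $H(t,x,u,q)=c(t,x,u)+q^\top f(t,x,u)$: for a class $L$ OCP, a uniformly Lipschitz function $J:[0,T]\times\mathbb{R}^n\to\mathbb{R}$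 is an admissible candidate value function if (1) $D^\pm J(t,x)=\partial_CJ(t,x)$ for all $(t,x)\in[0,T]\times\mathbb{R}^n$; and (2) there exist an admissible controller $\pi_J:[0,T]\times\mathbb{R}^n\to U$ and measurable functions $(p_J(t,x),q_J(t,x))\in D^\pm J(t,x)$ such that, for all $(t,x)\in[0,T]\times\mathbb{R}^n$, $$(p_J(t,x),q_J(t,x),\pi_J(t,x))\in\arg\inf_{(p,q,u)\in D^\pm J(t,x)\times U}\{p+H(t,x,u,q)\}.$$ Any such $\pi_J$ is called an associated admissible controller. $\|\cdot\|_2$ is the Euclidean norm and $B_R(0)=\{y\in\mathbb{R}^n:\|y\|_2<R\}$. *)

theory Defs
  imports "HOL-Analysis.Analysis" "HOL-Probability.Essential_Supremum"
begin

section \<open>Optimal control problems of class L\<close>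

text \<open>
  The condition on \<open>f\<close> and \<open>c\<close> in the time and input variables is uniform continuity of
  \<open>(t, u) \<mapsto> f t x u\<close> on \<open>[0,T] \<times> U\<close> for each fixed state \<open>x\<close> (no uniformity in \<open>x\<close> is asked for).
  The growth constant \<open>\<beta>\<^sub>f\<close> of \<open>f\<close> is kept as a parameter; all the other constants are
  existentially quantified.
\<close>

definition class_L ::
  "(real \<Rightarrow> real^'n \<Rightarrow> real^'m \<Rightarrow> real) \<Rightarrow> (real^'n \<Rightarrow> real) \<Rightarrow>
   (real \<Rightarrow> real^'n \<Rightarrow> real^'m \<Rightarrow> real^'n) \<Rightarrow> (real^'m) set \<Rightarrow> real \<Rightarrow> real \<Rightarrow> bool"
  where
  "class_L c g f U T \<beta>\<^sub>f \<longleftrightarrow>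
     T > 0 \<and> compact U \<and>
     (\<forall>x. uniformly_continuous_on ({0..T} \<times> U) (\<lambda>(t, u). f t x u)) \<and>
     (\<forall>x. uniformly_continuous_on ({0..T} \<times> U) (\<lambda>(t, u). c t x u)) \<and>
     (\<exists>\<alpha>\<^sub>f>0. \<forall>t\<in>{0..T}. \<forall>u\<in>U. \<forall>x y. norm (f t x u - f t y u) \<le> \<alpha>\<^sub>f * norm (x - y)) \<and>
     (\<exists>\<alpha>\<^sub>c>0. \<forall>t\<in>{0..T}. \<forall>u\<in>U. \<forall>x y. \<bar>c t x u - c t y u\<bar> \<le> \<alpha>\<^sub>c * norm (x - y)) \<and>
     (\<exists>\<alpha>\<^sub>g>0. \<forall>x y. \<bar>g x - g y\<bar> \<le> \<alpha>\<^sub>g * norm (x - y)) \<and>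
     \<beta>\<^sub>f > 0 \<and> (\<forall>t\<in>{0..T}. \<forall>u\<in>U. \<forall>x. norm (f t x u) \<le> \<beta>\<^sub>f * (1 + norm x)) \<and>
     (\<exists>\<beta>\<^sub>c>0. \<forall>t\<in>{0..T}. \<forall>u\<in>U. \<forall>x. \<bar>c t x u\<bar> \<le> \<beta>\<^sub>c * (1 + norm x)) \<and>
     (\<exists>\<beta>\<^sub>g>0. \<forall>x. \<bar>g x\<bar> \<le> \<beta>\<^sub>g * (1 + norm x))"


section \<open>Trajectories, inputs and the value function\<close>

text \<open>
  The usual epsilon-delta definition: the elements of a division are compact intervals
  \<open>[Inf k, Sup k]\<close> with pairwise disjoint interiors.
\<close>

definition absolutely_continuous_on :: "real set \<Rightarrow> (real \<Rightarrow> 'a::real_normed_vector) \<Rightarrow> bool"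
  where
  "absolutely_continuous_on S x \<longleftrightarrow>
     (\<forall>\<epsilon>>0. \<exists>\<delta>>0. \<forall>D E. D division_of E \<and> E \<subseteq> S \<and> (\<Sum>k\<in>D. Sup k - Inf k) < \<delta> \<longrightarrow>
        (\<Sum>k\<in>D. norm (x (Sup k) - x (Inf k))) < \<epsilon>)"

definition solves_ivp ::
  "(real \<Rightarrow> real^'n \<Rightarrow> real^'n) \<Rightarrow> real \<Rightarrow> real \<Rightarrow> real^'n \<Rightarrow> (real \<Rightarrow> real^'n) \<Rightarrow> bool"
  where
  "solves_ivp F t\<^sub>0 T x\<^sub>0 x \<longleftrightarrow>
     absolutely_continuous_on {t\<^sub>0..T} x \<and> x t\<^sub>0 = x\<^sub>0 \<and>
     (AE t in lebesgue_on {t\<^sub>0..T}. (x has_vector_derivative F t (x t)) (at t within {t\<^sub>0..T}))"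

definition admissible_input :: "(real^'m) set \<Rightarrow> real \<Rightarrow> real \<Rightarrow> (real \<Rightarrow> real^'m) \<Rightarrow> bool"
  where
  "admissible_input U t\<^sub>0 T u \<longleftrightarrow>
     u \<in> borel_measurable (lebesgue_on {t\<^sub>0..T}) \<and> (\<forall>t\<in>{t\<^sub>0..T}. u t \<in> U)"

definition total_cost ::
  "(real \<Rightarrow> real^'n \<Rightarrow> real^'m \<Rightarrow> real) \<Rightarrow> (real^'n \<Rightarrow> real) \<Rightarrow> real \<Rightarrow> real \<Rightarrow>
   (real \<Rightarrow> real^'n) \<Rightarrow> (real \<Rightarrow> real^'m) \<Rightarrow> real"
  where
  "total_cost c g t\<^sub>0 T x u = (LINT t|lebesgue_on {t\<^sub>0..T}. c t (x t) (u t)) + g (x T)"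

text \<open>
  In class L every admissible input has exactly one trajectory on \<open>[t\<^sub>0,T]\<close>, so the infimum over
  input-trajectory pairs is the infimum over admissible inputs. The linear growth bounds and the
  compactness of \<open>U\<close> bound the costs from below, hence the real-valued infimum is the proper
  one as soon as \<open>U\<close> is nonempty.
\<close>

definition value_function ::
  "(real \<Rightarrow> real^'n \<Rightarrow> real^'m \<Rightarrow> real) \<Rightarrow> (real^'n \<Rightarrow> real) \<Rightarrow>
   (real \<Rightarrow> real^'n \<Rightarrow> real^'m \<Rightarrow> real^'n) \<Rightarrow> (real^'m) set \<Rightarrow> real \<Rightarrow>
   real \<Rightarrow> real^'n \<Rightarrow> real"
  where
  "value_function c g f U T t\<^sub>0 x\<^sub>0 =
     Inf {total_cost c g t\<^sub>0 T x u | u x.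
            admissible_input U t\<^sub>0 T u \<and> solves_ivp (\<lambda>t z. f t z (u t)) t\<^sub>0 T x\<^sub>0 x}"

text \<open>
  Solutions are unique only on \<open>[0,T]\<close>; the values of the chosen function elsewhere are never used.
\<close>

definition trajectory ::
  "(real \<Rightarrow> real^'n \<Rightarrow> real^'n) \<Rightarrow> real \<Rightarrow> real^'n \<Rightarrow> real \<Rightarrow> real^'n"
  where
  "trajectory F T x\<^sub>0 = (SOME x. solves_ivp F 0 T x\<^sub>0 x)"

definition optimality_gap ::
  "(real \<Rightarrow> real^'n \<Rightarrow> real^'m \<Rightarrow> real) \<Rightarrow> (real^'n \<Rightarrow> real) \<Rightarrow>
   (real \<Rightarrow> real^'n \<Rightarrow> real^'m \<Rightarrow> real^'n) \<Rightarrow> (real^'m) set \<Rightarrow> real \<Rightarrow>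
   (real \<Rightarrow> real^'m) \<Rightarrow> real^'n \<Rightarrow> real"
  where
  "optimality_gap c g f U T u x\<^sub>0 =
     total_cost c g 0 T (trajectory (\<lambda>t z. f t z (u t)) T x\<^sub>0) u - value_function c g f U T 0 x\<^sub>0"


section \<open>Admissible controllers\<close>

text \<open>
  A Lebesgue measurable \<open>\<pi>\<close> need not have a measurable composition with a trajectory, so
  measurability of \<open>t \<mapsto> \<pi> (t, x t)\<close> is part of its being an admissible input. It is automatic
  when \<open>\<pi>\<close> is Borel measurable.
\<close>

definition admissible_controller ::
  "(real \<Rightarrow> real^'n \<Rightarrow> real^'m \<Rightarrow> real^'n) \<Rightarrow> (real^'m) set \<Rightarrow> real \<Rightarrow>
   (real \<times> (real^'n) \<Rightarrow> real^'m) \<Rightarrow> bool"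
  where
  "admissible_controller f U T \<pi> \<longleftrightarrow>
     \<pi> \<in> borel_measurable (lebesgue_on ({0..T} \<times> UNIV)) \<and>
     (\<forall>t\<^sub>0\<in>{0..T}. \<forall>x\<^sub>0. \<exists>x.
        solves_ivp (\<lambda>t z. f t z (\<pi> (t, z))) t\<^sub>0 T x\<^sub>0 x \<and>
        (\<forall>y. solves_ivp (\<lambda>t z. f t z (\<pi> (t, z))) t\<^sub>0 T x\<^sub>0 y \<longrightarrow> (\<forall>t\<in>{t\<^sub>0..T}. y t = x t)) \<and>
        admissible_input U t\<^sub>0 T (\<lambda>t. \<pi> (t, x t)))"

definition controller_input ::
  "(real \<Rightarrow> real^'n \<Rightarrow> real^'m \<Rightarrow> real^'n) \<Rightarrow> real \<Rightarrow> (real \<times> (real^'n) \<Rightarrow> real^'m) \<Rightarrow>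
   real^'n \<Rightarrow> real \<Rightarrow> real^'m"
  where
  "controller_input f T \<pi> x\<^sub>0 =
     (\<lambda>t. \<pi> (t, trajectory (\<lambda>t z. f t z (\<pi> (t, z))) T x\<^sub>0 t))"


section \<open>Generalized differentials\<close>

definition superdifferential :: "'a::euclidean_space set \<Rightarrow> ('a \<Rightarrow> real) \<Rightarrow> 'a \<Rightarrow> 'a set"
  where
  "superdifferential \<Omega> u x =
     {p. Limsup (at x within \<Omega>) (\<lambda>y. ereal ((u y - u x - p \<bullet> (y - x)) / norm (y - x))) \<le> 0}"

definition subdifferential :: "'a::euclidean_space set \<Rightarrow> ('a \<Rightarrow> real) \<Rightarrow> 'a \<Rightarrow> 'a set"
  where
  "subdifferential \<Omega> u x =
     {p. Liminf (at x within \<Omega>) (\<lambda>y. ereal ((u y - u x - p \<bullet> (y - x)) / norm (y - x))) \<ge> 0}"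

definition bidifferential :: "'a::euclidean_space set \<Rightarrow> ('a \<Rightarrow> real) \<Rightarrow> 'a \<Rightarrow> 'a set"
  where
  "bidifferential \<Omega> u x = superdifferential \<Omega> u x \<union> subdifferential \<Omega> u x"

text \<open>
  Only meaningful when \<open>x\<close> is interior to the domain of \<open>u\<close>: then \<open>y\<close> and \<open>y + h v\<close> eventually
  lie in the domain.
\<close>

definition clarke_gradient :: "('a::euclidean_space \<Rightarrow> real) \<Rightarrow> 'a \<Rightarrow> 'a set"
  where
  "clarke_gradient u x =
     {p. \<forall>v. ereal (p \<bullet> v) \<le>
           Limsup (nhds x \<times>\<^sub>F at_right 0) (\<lambda>(y, h). ereal ((u (y + h *\<^sub>R v) - u y) / h))}"


section \<open>Candidate value functions\<close>

definition hamiltonian ::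
  "(real \<Rightarrow> real^'n \<Rightarrow> real^'m \<Rightarrow> real) \<Rightarrow> (real \<Rightarrow> real^'n \<Rightarrow> real^'m \<Rightarrow> real^'n) \<Rightarrow>
   real \<Rightarrow> real^'n \<Rightarrow> real^'m \<Rightarrow> real^'n \<Rightarrow> real"
  where
  "hamiltonian c f t x u q = c t x u + q \<bullet> f t x u"

text \<open>
  The pointwise conditions on the differentials of \<open>J : [0,T] \<times> \<real>\<^sup>n \<rightarrow> \<real>\<close> are imposed at the interior
  points \<open>0 < t < T\<close>, on which the differentials relative to \<open>[0,T] \<times> \<real>\<^sup>n\<close> are the ordinary ones.
  At \<open>t = 0\<close> and \<open>t = T\<close> they cannot hold: there the one-sided super- and subdifferentials are
  unbounded in the time component whenever they are nonempty, whereas the Clarke gradient of a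
  Lipschitz function is nonempty and compact. The theorem needs nothing at these two times.
\<close>

definition associated_controller ::
  "(real \<Rightarrow> real^'n \<Rightarrow> real^'m \<Rightarrow> real) \<Rightarrow> (real \<Rightarrow> real^'n \<Rightarrow> real^'m \<Rightarrow> real^'n) \<Rightarrow>
   (real^'m) set \<Rightarrow> real \<Rightarrow> (real \<times> (real^'n) \<Rightarrow> real) \<Rightarrow> (real \<times> (real^'n) \<Rightarrow> real^'m) \<Rightarrow> bool"
  where
  "associated_controller c f U T J \<pi> \<longleftrightarrow>
     admissible_controller f U T \<pi> \<and>
     (\<forall>t\<in>{0..T}. \<forall>x. \<pi> (t, x) \<in> U) \<and>
     (\<exists>p\<^sub>J q\<^sub>J.
        p\<^sub>J \<in> borel_measurable (lebesgue_on ({0..T} \<times> UNIV)) \<and>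
        q\<^sub>J \<in> borel_measurable (lebesgue_on ({0..T} \<times> UNIV)) \<and>
        (\<forall>t\<in>{0<..<T}. \<forall>x.
           is_arg_min (\<lambda>(p, q, u). p + hamiltonian c f t x u q)
             (\<lambda>(p, q, u). (p, q) \<in> bidifferential ({0..T} \<times> UNIV) J (t, x) \<and> u \<in> U)
             (p\<^sub>J (t, x), q\<^sub>J (t, x), \<pi> (t, x))))"

definition admissible_candidate ::
  "(real \<Rightarrow> real^'n \<Rightarrow> real^'m \<Rightarrow> real) \<Rightarrow> (real \<Rightarrow> real^'n \<Rightarrow> real^'m \<Rightarrow> real^'n) \<Rightarrow>
   (real^'m) set \<Rightarrow> real \<Rightarrow> (real \<times> (real^'n) \<Rightarrow> real) \<Rightarrow> bool"
  where
  "admissible_candidate c f U T J \<longleftrightarrow>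
     (\<exists>K. K-lipschitz_on ({0..T} \<times> UNIV) J) \<and>
     (\<forall>t\<in>{0<..<T}. \<forall>x. bidifferential ({0..T} \<times> UNIV) J (t, x) = clarke_gradient J (t, x)) \<and>
     (\<exists>\<pi>. associated_controller c f U T J \<pi>)"


section \<open>Residuals of the Hamilton-Jacobi-Bellman equation\<close>

definition gradient :: "('a::euclidean_space \<Rightarrow> real) \<Rightarrow> 'a \<Rightarrow> 'a"
  where
  "gradient u x = (THE D. GDERIV u x :> D)"

text \<open>
  The residual has arbitrary values where \<open>J\<close> is not differentiable and at \<open>t = 0\<close>, \<open>t = T\<close>. These
  points form a Lebesgue null set, so they affect neither the essential supremum nor the measurability
  with respect to the (complete) Lebesgue measure.
\<close>

definition hjb_residual ::
  "(real \<Rightarrow> real^'n \<Rightarrow> real^'m \<Rightarrow> real) \<Rightarrow> (real \<Rightarrow> real^'n \<Rightarrow> real^'m \<Rightarrow> real^'n) \<Rightarrow>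
   (real^'m) set \<Rightarrow> (real \<times> (real^'n) \<Rightarrow> real) \<Rightarrow> real \<Rightarrow> real^'n \<Rightarrow> real"
  where
  "hjb_residual c f U J t x =
     deriv (\<lambda>s. J (s, x)) t + (INF u\<in>U. hamiltonian c f t x u (gradient (\<lambda>y. J (t, y)) x))"

end

theory Submission
  imports Defs
begin

text \<open>
  The bound is a verification argument. Write \<open>D\<^sub>1\<close>, \<open>D\<^sub>2\<close> for the two residuals, which may be taken finite, and let
  \<open>y\<close> be the trajectory of an input \<open>v\<close> starting at \<open>x\<^sub>0\<close>. Gronwall's inequality keeps \<open>y\<close> in the ball of
  radius \<open>R\<close>, the function \<open>t \<mapsto> J (t, y t)\<close> is absolutely continuous, and its derivative
  is the derivative of \<open>J\<close> in the direction \<open>(1, f t (y t) (v t))\<close>. If this derivative is at least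
  \<open>- D\<^sub>1 - c t (y t) (v t)\<close> for almost all \<open>t\<close>, then integration shows that the cost of \<open>v\<close> is at least
  \<open>J (0, x\<^sub>0) - T D\<^sub>1 - D\<^sub>2\<close>. If it is at most \<open>D\<^sub>1 - c t (y t) (v t)\<close> for the closed loop of \<open>\<pi>\<^sub>J\<close>, then the
  closed loop costs at most \<open>J (0, x\<^sub>0) + T D\<^sub>1 + D\<^sub>2\<close>. Comparing the second estimate with the infimum of the
  first gives \<open>2 T D\<^sub>1 + 2 D\<^sub>2\<close>. The work is to pass from the residual, which only speaks of almost all
  points, to the null set of points that a single trajectory visits.

  The equation of the bidifferential and the Clarke gradient makes this possible. The super- and the
  subdifferential can only be both nonempty at a point if they are the same singleton, so at each
  interior point the Clarke gradient is contained in one of them. By convex duality the Clarke derivative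
  in any direction is attained by an element of the Clarke gradient; hence \<open>J\<close> has one-sided derivatives
  in all directions at all interior points (\<open>clarke_regular_dir_deriv\<close>). A real function with one-sided
  derivatives everywhere has at most countably many kinks (\<open>countable_one_sided_derivs_differ\<close>). On lines this
  yields, by Fubini, that \<open>J\<close> is differentiable almost everywhere, so the residual is given by true gradients;
  along trajectories it yields that the two one-sided derivatives agree at almost all times.

  For the lower estimate (\<open>dir_deriv_lower_bound\<close>) the direction \<open>d = (1, f t x u)\<close> is frozen at a point \<open>z\<close>.
  Almost every line parallel to \<open>d\<close> meets the exceptional null set of the Hamilton-Jacobi-Bellman
  inequality in a null set of the line, so increments of \<open>J\<close> along it are bounded below; continuity of \<open>J\<close> carries
  the bound over to the line through \<open>z\<close>.

  For the upper estimate (\<open>dir_deriv_upper_bound\<close>) points of differentiability with small residual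
  are chosen that tend to \<open>z\<close>. Limits of gradients lie in the Clarke gradient and \<open>U\<close> is compact, so some element
  \<open>(p, q)\<close> of the Clarke gradient and some \<open>u \<in> U\<close> satisfy \<open>p + H(t, x, u, q) \<le> D\<^sub>1\<close>; the minimising triple
  \<open>(p\<^sub>J, q\<^sub>J, \<pi>\<^sub>J)\<close> does no worse. A superdifferential element bounds the forward derivative of \<open>J\<close> along
  the trajectory from above, a subdifferential element the backward one, and the two agree at almost all times.
\<close>

section \<open>One-sided directional derivatives\<close>

text \<open>
  One-sided, so that \<open>has_dir_deriv \<phi> t (-1) l\<close> says that the left derivative of \<open>\<phi> :: real \<Rightarrow> real\<close> at \<open>t\<close>
  is \<open>- l\<close>.
\<close>

definition has_dir_deriv :: "('a::real_normed_vector \<Rightarrow> real) \<Rightarrow> 'a \<Rightarrow> 'a \<Rightarrow> real \<Rightarrow> bool" where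
  "has_dir_deriv J z v l \<longleftrightarrow> ((\<lambda>h. (J (z + h *\<^sub>R v) - J z) / h) \<longlongrightarrow> l) (at_right 0)"

lemma has_dir_derivI:
  assumes upper: "\<And>e. e > 0 \<Longrightarrow> \<forall>\<^sub>F h in at_right 0. J (z + h *\<^sub>R v) - J z \<le> h * (l + e)"
    and lower: "\<And>e. e > 0 \<Longrightarrow> \<forall>\<^sub>F h in at_right 0. h * (l - e) \<le> J (z + h *\<^sub>R v) - J z"
  shows "has_dir_deriv J z v l"
  unfolding has_dir_deriv_def
proof (rule tendstoI)
  fix e :: real assume "e > 0"
  then have e: "e / 2 > 0" by simp
  show "\<forall>\<^sub>F h in at_right 0. dist ((J (z + h *\<^sub>R v) - J z) / h) l < e"
    using upper[OF e] lower[OF e] eventually_at_right_less[of 0]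
  proof eventually_elim
    case (elim h)
    then have "(J (z + h *\<^sub>R v) - J z) / h \<le> l + e / 2" "l - e / 2 \<le> (J (z + h *\<^sub>R v) - J z) / h"
      by (simp_all only: pos_divide_le_eq pos_le_divide_eq mult.commute)
    then show ?case using e by (simp add: dist_real_def abs_less_iff)
  qed
qed

lemma has_dir_deriv_unique:
  "has_dir_deriv J z v l \<Longrightarrow> has_dir_deriv J z v l' \<Longrightarrow> l = l'"
  unfolding has_dir_deriv_def by (rule tendsto_unique) auto

lemma has_real_derivative_if_dir_derivs:
  fixes \<phi> :: "real \<Rightarrow> real"
  assumes "has_dir_deriv \<phi> t 1 r" "has_dir_deriv \<phi> t (-1) (-r)"
  shows "(\<phi> has_real_derivative r) (at t)"
proof -
  have 1: "((\<lambda>h. (\<phi> (t + h) - \<phi> t) / h) \<longlongrightarrow> r) (at_right 0)"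
    using assms(1) by (simp add: has_dir_deriv_def)
  have "((\<lambda>h. - ((\<phi> (t - h) - \<phi> t) / h)) \<longlongrightarrow> - (- r)) (at_right 0)"
    using assms(2) by (intro tendsto_minus) (simp add: has_dir_deriv_def)
  then have 2: "((\<lambda>h. (\<phi> (t + h) - \<phi> t) / h) \<longlongrightarrow> r) (at_left 0)"
    by (simp add: filterlim_at_left_to_right)
  show ?thesis
    unfolding DERIV_def using filterlim_split_at[OF 2 1] by simp
qed

text \<open>
  If the right derivative exceeds the left one, a rational slope \<open>q\<close> fits strictly between them, and \<open>t\<close> is
  the only minimiser of \<open>\<phi> s - q s\<close> on some interval with rational end points. The three rationals
  determine \<open>t\<close>. The other sign is the same statement for \<open>- \<phi>\<close>.
\<close>

lemma countable_one_sided_derivs_differ: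
  fixes \<phi> :: "real \<Rightarrow> real"
  shows "countable {t. \<exists>r l. has_dir_deriv \<phi> t 1 r \<and> has_dir_deriv \<phi> t (-1) l \<and> r \<noteq> - l}"
proof -
  have kink: "countable {t. \<exists>r l. has_dir_deriv \<psi> t 1 r \<and> has_dir_deriv \<psi> t (-1) l \<and> r > - l}"
    (is "countable ?A") for \<psi> :: "real \<Rightarrow> real"
  proof -
    define M where "M = (\<lambda>(q, a, b). {t. a < t \<and> t < b \<and>
      (\<forall>s. a < s \<and> s < b \<and> s \<noteq> t \<longrightarrow> \<psi> t - q * t < \<psi> s - q * s)})"
    have "?A \<subseteq> (\<Union>w \<in> \<rat> \<times> \<rat> \<times> \<rat>. M w)"
    proof
      fix t assume "t \<in> ?A"
      then obtain r l where r: "has_dir_deriv \<psi> t 1 r" and l: "has_dir_deriv \<psi> t (-1) l" and "r > - l"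
        by blast
      obtain q where q: "q \<in> \<rat>" "- l < q" "q < r" using Rats_dense_in_real[OF \<open>r > - l\<close>] by blast
      have "\<forall>\<^sub>F h in at_right 0. q < (\<psi> (t + h) - \<psi> t) / h"
        using order_tendstoD(1)[OF r[unfolded has_dir_deriv_def] q(3)] by simp
      then obtain b where b: "b > 0" "\<And>h. 0 < h \<Longrightarrow> h < b \<Longrightarrow> q < (\<psi> (t + h) - \<psi> t) / h"
        unfolding eventually_at_right_field by auto
      have "\<forall>\<^sub>F h in at_right 0. - q < (\<psi> (t - h) - \<psi> t) / h"
        using order_tendstoD(1)[OF l[unfolded has_dir_deriv_def], of "-q"] q(2) by simp
      then obtain a where a: "a > 0" "\<And>h. 0 < h \<Longrightarrow> h < a \<Longrightarrow> - q < (\<psi> (t - h) - \<psi> t) / h"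
        unfolding eventually_at_right_field by auto
      obtain a' where a': "a' \<in> \<rat>" "t - a < a'" "a' < t" using Rats_dense_in_real[of "t - a" t] a by auto
      obtain b' where b': "b' \<in> \<rat>" "t < b'" "b' < t + b" using Rats_dense_in_real[of t "t + b"] b by auto
      have "\<psi> t - q * t < \<psi> s - q * s" if s: "a' < s" "s < b'" "s \<noteq> t" for s
      proof (cases "s > t")
        case True
        then show ?thesis using b(2)[of "s - t"] s b' by (simp add: field_simps)
      next
        case False
        then show ?thesis using a(2)[of "t - s"] s a' by (simp add: field_simps)
      qed
      then have "t \<in> M (q, a', b')" using a' b' by (simp add: M_def)
      then show "t \<in> (\<Union>w \<in> \<rat> \<times> \<rat> \<times> \<rat>. M w)" using q a' b' by blast
    qed
    moreover have "countable (M w)" for w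
    proof -
      have "t = t'" if "t \<in> M w" "t' \<in> M w" for t t'
      proof (rule ccontr)
        obtain q a b where w: "w = (q, a, b)" by (cases w)
        assume "t \<noteq> t'"
        then have "\<psi> t - q * t < \<psi> t' - q * t'" "\<psi> t' - q * t' < \<psi> t - q * t"
          using that by (auto simp: M_def w)
        then show False by linarith
      qed
      then have "\<exists>x. M w \<subseteq> {x}" by blast
      then show ?thesis by (meson countable_empty countable_insert countable_subset)
    qed
    ultimately show ?thesis
      by (meson countable_SIGMA countable_UN countable_rat countable_subset)
  qed
  have neg: "has_dir_deriv (\<lambda>x. - \<phi> x) t v (- l)" if "has_dir_deriv \<phi> t v l" for t v l
    using tendsto_minus[OF that[unfolded has_dir_deriv_def]]
    by (simp add: has_dir_deriv_def minus_divide_left)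
  have "{t. \<exists>r l. has_dir_deriv \<phi> t 1 r \<and> has_dir_deriv \<phi> t (-1) l \<and> r \<noteq> - l} \<subseteq>
     {t. \<exists>r l. has_dir_deriv \<phi> t 1 r \<and> has_dir_deriv \<phi> t (-1) l \<and> r > - l} \<union>
     {t. \<exists>r l. has_dir_deriv (\<lambda>x. - \<phi> x) t 1 r \<and> has_dir_deriv (\<lambda>x. - \<phi> x) t (-1) l \<and> r > - l}"
  proof
    fix t assume "t \<in> {t. \<exists>r l. has_dir_deriv \<phi> t 1 r \<and> has_dir_deriv \<phi> t (-1) l \<and> r \<noteq> - l}"
    then obtain r l where rl: "has_dir_deriv \<phi> t 1 r" "has_dir_deriv \<phi> t (-1) l" "r \<noteq> - l" by blast
    then have "r > - l \<or> - r > - (- l)" by linarith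
    then show "t \<in> {t. \<exists>r l. has_dir_deriv \<phi> t 1 r \<and> has_dir_deriv \<phi> t (-1) l \<and> r > - l} \<union>
     {t. \<exists>r l. has_dir_deriv (\<lambda>x. - \<phi> x) t 1 r \<and> has_dir_deriv (\<lambda>x. - \<phi> x) t (-1) l \<and> r > - l}"
      using rl neg by blast
  qed
  then show ?thesis by (rule countable_subset[OF _ countable_Un[OF kink kink]])
qed

text \<open>
  A Lipschitz function cannot tell a curve from its tangent to first order. The factor \<open>e\<close> is \<open>1\<close> or
  \<open>-1\<close> in the applications and covers both sides of \<open>t\<close> at once.
\<close>

lemma has_dir_deriv_along_curve:
  fixes J :: "'a::real_normed_vector \<Rightarrow> real"
  assumes lip: "K-lipschitz_on \<Omega> J" and "open \<Omega>" "\<gamma> t \<in> \<Omega>"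
    and \<gamma>: "(\<gamma> has_vector_derivative w) (at t)"
    and J: "has_dir_deriv J (\<gamma> t) (e *\<^sub>R w) r"
  shows "has_dir_deriv (\<lambda>s. J (\<gamma> s)) t e r"
proof -
  have d: "((\<lambda>h. t + h * e) \<longlongrightarrow> t) (at_right 0)"
    by (auto intro!: tendsto_eq_intros)
  have "((\<lambda>h. t + h * e) has_vector_derivative e) (at 0)"
    by (auto intro!: derivative_eq_intros simp: has_real_derivative_iff_has_vector_derivative[symmetric])
  then have "((\<lambda>h. \<gamma> (t + h * e)) has_vector_derivative (e *\<^sub>R w)) (at 0)"
    using vector_diff_chain_at[of "\<lambda>h. t + h * e" e 0 \<gamma> w] \<gamma> by (simp add: o_def)
  then have "((\<lambda>h. norm (\<gamma> (t + h * e) - \<gamma> t - h *\<^sub>R (e *\<^sub>R w)) / norm h) \<longlongrightarrow> 0) (at 0)"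
    unfolding has_vector_derivative_def has_derivative_at by simp
  then have q: "((\<lambda>h. norm (\<gamma> (t + h * e) - \<gamma> t - h *\<^sub>R (e *\<^sub>R w)) / norm h) \<longlongrightarrow> 0) (at_right 0)"
    by (rule tendsto_within_subset) auto
  have "continuous (at t) \<gamma>" by (rule has_vector_derivative_continuous[OF \<gamma>])
  then have "((\<lambda>h. \<gamma> (t + h * e)) \<longlongrightarrow> \<gamma> t) (at_right 0)"
    using isCont_tendsto_compose[OF _ d] by auto
  then have in1: "\<forall>\<^sub>F h in at_right 0. \<gamma> (t + h * e) \<in> \<Omega>"
    by (rule topological_tendstoD[OF _ assms(2,3)])
  have "((\<lambda>h. \<gamma> t + h *\<^sub>R (e *\<^sub>R w)) \<longlongrightarrow> \<gamma> t) (at_right 0)"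
    by (auto intro!: tendsto_eq_intros)
  then have in2: "\<forall>\<^sub>F h in at_right 0. \<gamma> t + h *\<^sub>R (e *\<^sub>R w) \<in> \<Omega>"
    by (rule topological_tendstoD[OF _ assms(2,3)])
  have "((\<lambda>h. (J (\<gamma> (t + h * e)) - J (\<gamma> t + h *\<^sub>R (e *\<^sub>R w))) / h) \<longlongrightarrow> 0) (at_right 0)"
  proof (rule Lim_null_comparison)
    show "((\<lambda>h. K * (norm (\<gamma> (t + h * e) - \<gamma> t - h *\<^sub>R (e *\<^sub>R w)) / norm h)) \<longlongrightarrow> 0) (at_right 0)"
      using q by (rule tendsto_mult_right_zero)
    show "\<forall>\<^sub>F h in at_right 0. norm ((J (\<gamma> (t + h * e)) - J (\<gamma> t + h *\<^sub>R (e *\<^sub>R w))) / h) \<le>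
       K * (norm (\<gamma> (t + h * e) - \<gamma> t - h *\<^sub>R (e *\<^sub>R w)) / norm h)"
      using in1 in2 eventually_at_right_less[of 0]
    proof eventually_elim
      case (elim h)
      have "norm (J (\<gamma> (t + h * e)) - J (\<gamma> t + h *\<^sub>R (e *\<^sub>R w))) \<le>
         K * norm (\<gamma> (t + h * e) - (\<gamma> t + h *\<^sub>R (e *\<^sub>R w)))"
        using lipschitz_onD[OF lip elim(1,2)] by (simp add: dist_norm)
      then show ?case using elim by (simp add: divide_right_mono diff_diff_eq)
    qed
  qed
  from tendsto_add[OF this J[unfolded has_dir_deriv_def]] show ?thesis
    unfolding has_dir_deriv_def by (simp add: add_divide_distrib[symmetric])
qed

section \<open>The Clarke derivative of a Lipschitz function\<close>

lemma eventually_nhds_at_right_iff: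
  fixes z :: "'a::metric_space"
  shows "(\<forall>\<^sub>F (y, h) in nhds z \<times>\<^sub>F at_right (0::real). P y h) \<longleftrightarrow>
     (\<exists>d>0. \<forall>y h. dist y z < d \<longrightarrow> 0 < h \<longrightarrow> h < d \<longrightarrow> P y h)"
proof
  assume "\<forall>\<^sub>F (y, h) in nhds z \<times>\<^sub>F at_right (0::real). P y h"
  then obtain Pf Pg where "eventually Pf (nhds z)" "eventually Pg (at_right (0::real))"
    and P: "\<And>y h. Pf y \<Longrightarrow> Pg h \<Longrightarrow> P y h"
    unfolding eventually_prod_filter by auto
  then obtain d e where "d > 0" "\<And>y. dist y z < d \<Longrightarrow> Pf y" "e > 0" "\<And>h. 0 < h \<Longrightarrow> h < e \<Longrightarrow> Pg h"
    unfolding eventually_nhds_metric eventually_at_right_field by auto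
  then show "\<exists>d>0. \<forall>y h. dist y z < d \<longrightarrow> 0 < h \<longrightarrow> h < d \<longrightarrow> P y h"
    using P by (intro exI[of _ "min d e"]) auto
next
  assume "\<exists>d>0. \<forall>y h. dist y z < d \<longrightarrow> 0 < h \<longrightarrow> h < d \<longrightarrow> P y h"
  then obtain d where d: "d > 0" "\<And>y h. dist y z < d \<Longrightarrow> 0 < h \<Longrightarrow> h < d \<Longrightarrow> P y h" by blast
  have "eventually (\<lambda>y. dist y z < d) (nhds z)"
    unfolding eventually_nhds_metric using d(1) by blast
  moreover have "eventually (\<lambda>h. 0 < h \<and> h < d) (at_right 0)"
    unfolding eventually_at_right_field using d(1) by auto
  ultimately show "\<forall>\<^sub>F (y, h) in nhds z \<times>\<^sub>F at_right (0::real). P y h"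
    unfolding eventually_prod_filter using d(2) by fastforce
qed

text \<open>
  The upper bounds of the difference quotients near \<open>z\<close>. Their infimum \<open>clarke_deriv\<close> is the real-valued form of the
  limit superior in \<open>clarke_gradient\<close>, that is Clarke's generalized directional derivative.
\<close>

definition clarke_slopes :: "('a::real_normed_vector \<Rightarrow> real) \<Rightarrow> 'a \<Rightarrow> 'a \<Rightarrow> real set" where
  "clarke_slopes J z v =
     {m. \<exists>d>0. \<forall>y h. dist y z < d \<longrightarrow> 0 < h \<longrightarrow> h < d \<longrightarrow> J (y + h *\<^sub>R v) - J y \<le> h * m}"

definition clarke_deriv :: "('a::real_normed_vector \<Rightarrow> real) \<Rightarrow> 'a \<Rightarrow> 'a \<Rightarrow> real" where
  "clarke_deriv J z v = Inf (clarke_slopes J z v)"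

lemma clarke_slopes_mono: "m \<in> clarke_slopes J z v \<Longrightarrow> m \<le> m' \<Longrightarrow> m' \<in> clarke_slopes J z v"
  unfolding clarke_slopes_def mem_Collect_eq
  by (meson less_imp_le mult_left_mono order_trans)

lemma clarke_gradient_iff_slopes:
  "p \<in> clarke_gradient J z \<longleftrightarrow> (\<forall>v. \<forall>m\<in>clarke_slopes J z v. p \<bullet> v \<le> m)"
proof -
  have slope: "m \<in> clarke_slopes J z v \<longleftrightarrow>
      (\<forall>\<^sub>F w in nhds z \<times>\<^sub>F at_right 0. (case w of (y, h) \<Rightarrow> ereal ((J (y + h *\<^sub>R v) - J y) / h)) \<le> ereal m)"
    for m v
  proof -
    have "m \<in> clarke_slopes J z v \<longleftrightarrow>
      (\<forall>\<^sub>F (y, h) in nhds z \<times>\<^sub>F at_right 0. ereal ((J (y + h *\<^sub>R v) - J y) / h) \<le> ereal m)"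
      unfolding eventually_nhds_at_right_iff clarke_slopes_def
      by (auto simp: field_simps)
    then show ?thesis by (simp add: case_prod_unfold)
  qed
  show ?thesis
  proof (intro iffI allI ballI)
    fix v m assume p: "p \<in> clarke_gradient J z" and "m \<in> clarke_slopes J z v"
    then have "Limsup (nhds z \<times>\<^sub>F at_right 0) (\<lambda>(y, h). ereal ((J (y + h *\<^sub>R v) - J y) / h)) \<le> ereal m"
      by (intro Limsup_bounded) (simp add: slope)
    moreover have "ereal (p \<bullet> v) \<le>
       Limsup (nhds z \<times>\<^sub>F at_right 0) (\<lambda>(y, h). ereal ((J (y + h *\<^sub>R v) - J y) / h))"
      using p by (simp add: clarke_gradient_def)
    ultimately have "ereal (p \<bullet> v) \<le> ereal m" by (rule order_trans[rotated])
    then show "p \<bullet> v \<le> m" by simp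
  next
    assume R: "\<forall>v. \<forall>m\<in>clarke_slopes J z v. p \<bullet> v \<le> m"
    have "ereal (p \<bullet> v) \<le>
       Limsup (nhds z \<times>\<^sub>F at_right 0) (\<lambda>(y, h). ereal ((J (y + h *\<^sub>R v) - J y) / h))" (is "_ \<le> ?L") for v
    proof (rule ccontr)
      assume "\<not> ereal (p \<bullet> v) \<le> ?L"
      then have "?L < ereal (p \<bullet> v)" by simp
      from ereal_dense2[OF this] obtain m where m: "?L < ereal m" "m < p \<bullet> v" by auto
      have "m \<in> clarke_slopes J z v"
        unfolding slope using Limsup_lessD[OF m(1)] by (rule eventually_mono) simp
      then show False using R m(2) by fastforce
    qed
    then show "p \<in> clarke_gradient J z" by (simp add: clarke_gradient_def)
  qed
qed

text \<open>
  This is the Hahn-Banach theorem in finite dimension: a hyperplane separating the point \<open>(v\<^sub>0, s v\<^sub>0)\<close>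
  from the strict epigraph of \<open>s\<close>, which is a convex cone, is the graph of the functional.
\<close>

lemma support_functional_sublinear:
  fixes s :: "'a::euclidean_space \<Rightarrow> real"
  assumes add: "\<And>v w. s (v + w) \<le> s v + s w" and scale: "\<And>a v. a > 0 \<Longrightarrow> s (a *\<^sub>R v) = a * s v"
  obtains p where "p \<bullet> v\<^sub>0 = s v\<^sub>0" "\<And>w. p \<bullet> w \<le> s w"
proof -
  define C where "C = {(w, r). s w < r}"
  have "convex C"
  proof (rule convexI)
    fix x y :: "'a \<times> real" and u v :: real
    assume x: "x \<in> C" and y: "y \<in> C" and uv: "0 \<le> u" "0 \<le> v" "u + v = 1"
    obtain w r w' r' where xy: "x = (w, r)" "y = (w', r')" by fastforce
    have lt: "s w < r" "s w' < r'" using x y by (auto simp: C_def xy)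
    have "s (u *\<^sub>R w + v *\<^sub>R w') < u * r + v * r'"
    proof (cases "u = 0 \<or> v = 0")
      case True
      then show ?thesis using uv lt by auto
    next
      case False
      then have "u > 0" "v > 0" using uv by auto
      then have "s (u *\<^sub>R w + v *\<^sub>R w') \<le> u * s w + v * s w'"
        using add[of "u *\<^sub>R w" "v *\<^sub>R w'"] scale by simp
      also have "\<dots> < u * r + v * r'"
        using lt \<open>u > 0\<close> \<open>v > 0\<close> by (simp add: add_strict_mono)
      finally show ?thesis .
    qed
    then show "u *\<^sub>R x + v *\<^sub>R y \<in> C" by (simp add: C_def xy)
  qed
  have "(v\<^sub>0, s v\<^sub>0 + 1) \<in> C" by (simp add: C_def)
  then have "C \<noteq> {}" by blast
  have "C \<inter> {(v\<^sub>0, s v\<^sub>0)} = {}" by (auto simp: C_def)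
  from separating_hyperplane_sets[OF \<open>convex C\<close> convex_singleton \<open>C \<noteq> {}\<close> _ this]
  obtain z b where z: "z \<noteq> 0" and zC: "\<And>x. x \<in> C \<Longrightarrow> z \<bullet> x \<le> b" and zv: "z \<bullet> (v\<^sub>0, s v\<^sub>0) \<ge> b"
    by blast
  obtain a \<alpha> where a: "z = (a, \<alpha>)" by fastforce
  have le: "a \<bullet> w + \<alpha> * r \<le> b" if "s w < r" for w r
    using zC[of "(w, r)"] that by (simp add: C_def a)
  \<comment> \<open>The epigraph is a cone, so a bound on the linear form there is a bound by zero.\<close>
  have le0: "a \<bullet> w + \<alpha> * r \<le> 0" if "s w < r" for w r
  proof (rule ccontr)
    assume pos: "\<not> a \<bullet> w + \<alpha> * r \<le> 0"
    define k where "k = (\<bar>b\<bar> + 1) / (a \<bullet> w + \<alpha> * r)"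
    have "k > 0" using pos by (simp add: k_def)
    then have "k * (a \<bullet> w + \<alpha> * r) \<le> b"
      using le[of "k *\<^sub>R w" "k * r"] scale that by (simp add: algebra_simps)
    moreover have "k * (a \<bullet> w + \<alpha> * r) = \<bar>b\<bar> + 1" using pos by (simp add: k_def)
    ultimately show False by linarith
  qed
  have s0: "s 0 = 0" using scale[of 2 0] by simp
  have b0: "b \<ge> 0"
  proof (rule ccontr)
    assume "\<not> b \<ge> 0"
    then have b: "b < 0" by simp
    define k where "k = - b / (2 * (\<bar>\<alpha>\<bar> + 1))"
    have k: "k > 0" unfolding k_def using b by (intro divide_pos_pos) auto
    have "\<alpha> * k \<le> b" using le[of 0 k] s0 k by simp
    moreover have "\<alpha> * k \<ge> - \<bar>\<alpha>\<bar> * k" using k by (intro mult_right_mono) auto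
    moreover have "\<bar>\<alpha>\<bar> * k \<le> - b / 2" using b unfolding k_def by (simp add: field_simps)
    ultimately show False using b by linarith
  qed
  \<comment> \<open>The point \<open>(w, s w)\<close> of the graph is a limit of points of the strict epigraph.\<close>
  have nonpos: "a \<bullet> w + \<alpha> * s w \<le> 0" for w
  proof (rule field_le_epsilon)
    fix e :: real assume "e > 0"
    define k where "k = e / (\<bar>\<alpha>\<bar> + 1)"
    have k: "k > 0" "\<bar>\<alpha>\<bar> * k \<le> e" using \<open>e > 0\<close> by (auto simp: k_def field_simps)
    have "a \<bullet> w + \<alpha> * (s w + k) \<le> 0" using le0[of w "s w + k"] k by simp
    moreover have "\<alpha> * k \<ge> - \<bar>\<alpha>\<bar> * k" using k by (intro mult_right_mono) auto
    ultimately show "a \<bullet> w + \<alpha> * s w \<le> 0 + e" using k by (simp add: algebra_simps)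
  qed
  \<comment> \<open>The hyperplane is not vertical, because the epigraph projects onto the whole space.\<close>
  have "\<alpha> \<le> 0" using le0[of 0 1] s0 by simp
  moreover have "\<alpha> \<noteq> 0"
  proof
    assume "\<alpha> = 0"
    then have "a \<bullet> a \<le> 0" using nonpos[of a] by simp
    then have "a = 0" using inner_ge_zero[of a] by (metis antisym inner_eq_zero_iff)
    then show False using z a \<open>\<alpha> = 0\<close> by (simp add: zero_prod_def)
  qed
  ultimately have \<alpha>: "\<alpha> < 0" by simp
  show thesis
  proof (rule that[of "(1 / (- \<alpha>)) *\<^sub>R a"])
    show *: "((1 / (- \<alpha>)) *\<^sub>R a) \<bullet> w \<le> s w" for w
      using nonpos[of w] \<alpha> by (simp add: field_simps)
    have "a \<bullet> v\<^sub>0 + \<alpha> * s v\<^sub>0 \<ge> 0" using zv b0 by (simp add: a)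
    then have "((1 / (- \<alpha>)) *\<^sub>R a) \<bullet> v\<^sub>0 \<ge> s v\<^sub>0" using \<alpha> by (simp add: field_simps)
    then show "((1 / (- \<alpha>)) *\<^sub>R a) \<bullet> v\<^sub>0 = s v\<^sub>0" using * by (simp add: antisym)
  qed
qed

context
  fixes J :: "'a::euclidean_space \<Rightarrow> real" and K \<Omega> z
  assumes lip: "K-lipschitz_on \<Omega> J" and z: "z \<in> interior \<Omega>"
begin

lemma lipschitz_quotient_bound:
  "\<exists>d>0. \<forall>y h. dist y z < d \<longrightarrow> 0 < h \<longrightarrow> h < d \<longrightarrow> \<bar>J (y + h *\<^sub>R v) - J y\<bar> \<le> h * (K * norm v)"
proof -
  obtain r where r: "r > 0" "ball z r \<subseteq> \<Omega>" using z by (meson mem_interior)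
  define d where "d = r / (1 + norm v)"
  have pos: "1 + norm v > 0" by (simp add: add_pos_nonneg)
  have d: "d > 0" "d * (1 + norm v) = r"
    using r pos by (auto simp: d_def)
  have "d \<le> r" using d(2) mult_nonneg_nonneg[OF less_imp_le[OF d(1)] norm_ge_zero[of v]]
    by (simp add: algebra_simps)
  show ?thesis
  proof (intro exI[of _ d] conjI d(1) allI impI)
    fix y h assume yh: "dist y z < d" "0 < h" "h < d"
    have "dist (y + h *\<^sub>R v) z \<le> dist y z + h * norm v"
      using norm_triangle_ineq[of "y - z" "h *\<^sub>R v"] yh by (simp add: dist_norm algebra_simps)
    also have "\<dots> < d + d * norm v"
      using yh by (intro add_less_le_mono mult_right_mono) auto
    also have "\<dots> = r" using d by (simp add: algebra_simps)
    finally have "y + h *\<^sub>R v \<in> \<Omega>" "y \<in> \<Omega>" using r yh \<open>d \<le> r\<close> by (auto simp: dist_commute)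
    from lipschitz_onD[OF lip this] show "\<bar>J (y + h *\<^sub>R v) - J y\<bar> \<le> h * (K * norm v)"
      using yh by (simp add: dist_norm algebra_simps)
  qed
qed

lemma clarke_slopes_nonempty: "K * norm v \<in> clarke_slopes J z v"
proof -
  obtain d where "d > 0"
    "\<forall>y h. dist y z < d \<longrightarrow> 0 < h \<longrightarrow> h < d \<longrightarrow> \<bar>J (y + h *\<^sub>R v) - J y\<bar> \<le> h * (K * norm v)"
    using lipschitz_quotient_bound[of v] by blast
  then show ?thesis unfolding clarke_slopes_def by (intro CollectI exI[of _ d]) (simp add: abs_le_iff)
qed

lemma clarke_slopes_bounded_below: "m \<in> clarke_slopes J z v \<Longrightarrow> - (K * norm v) \<le> m"
proof -
  assume "m \<in> clarke_slopes J z v"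
  then obtain d where d: "d > 0"
    "\<forall>y h. dist y z < d \<longrightarrow> 0 < h \<longrightarrow> h < d \<longrightarrow> J (y + h *\<^sub>R v) - J y \<le> h * m"
    unfolding clarke_slopes_def by blast
  obtain d' where d': "d' > 0"
    "\<forall>y h. dist y z < d' \<longrightarrow> 0 < h \<longrightarrow> h < d' \<longrightarrow> \<bar>J (y + h *\<^sub>R v) - J y\<bar> \<le> h * (K * norm v)"
    using lipschitz_quotient_bound[of v] by blast
  define h where "h = min d d' / 2"
  have h: "h > 0" "h < d" "h < d'" using d d' by (auto simp: h_def)
  have "h * (- (K * norm v)) \<le> h * m"
    using d(2)[rule_format, of z h] d'(2)[rule_format, of z h] h d(1) d'(1) by auto
  then show ?thesis using h(1) by (simp only: mult_le_cancel_left_pos)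
qed

lemma bdd_below_clarke_slopes: "bdd_below (clarke_slopes J z v)"
  using clarke_slopes_bounded_below by (rule bdd_belowI)

lemma clarke_deriv_le: "m \<in> clarke_slopes J z v \<Longrightarrow> clarke_deriv J z v \<le> m"
  unfolding clarke_deriv_def using bdd_below_clarke_slopes by (rule cInf_lower[rotated])

lemma clarke_slopesI:
  assumes "clarke_deriv J z v < m"
  shows "m \<in> clarke_slopes J z v"
proof -
  have "clarke_slopes J z v \<noteq> {}" using clarke_slopes_nonempty by blast
  from cInf_lessD[OF this assms[unfolded clarke_deriv_def]]
  obtain m' where m': "m' \<in> clarke_slopes J z v" "m' < m" by blast
  show ?thesis by (rule clarke_slopes_mono[OF m'(1) less_imp_le[OF m'(2)]])
qed

lemma clarke_deriv_upper_bound: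
  "clarke_deriv J z v < m \<Longrightarrow>
     \<exists>d>0. \<forall>y h. dist y z < d \<longrightarrow> 0 < h \<longrightarrow> h < d \<longrightarrow> J (y + h *\<^sub>R v) - J y \<le> h * m"
  using clarke_slopesI[of v m] unfolding clarke_slopes_def mem_Collect_eq .

lemma clarke_gradient_iff: "p \<in> clarke_gradient J z \<longleftrightarrow> (\<forall>v. p \<bullet> v \<le> clarke_deriv J z v)"
proof -
  have "(\<forall>m\<in>clarke_slopes J z v. p \<bullet> v \<le> m) \<longleftrightarrow> p \<bullet> v \<le> clarke_deriv J z v" for v
  proof
    assume "\<forall>m\<in>clarke_slopes J z v. p \<bullet> v \<le> m"
    then have "p \<bullet> v \<le> m" if "clarke_deriv J z v < m" for m
      using clarke_slopesI[OF that] by blast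
    then show "p \<bullet> v \<le> clarke_deriv J z v" by (rule dense_ge)
  next
    assume "p \<bullet> v \<le> clarke_deriv J z v"
    then show "\<forall>m\<in>clarke_slopes J z v. p \<bullet> v \<le> m"
      using clarke_deriv_le[of _ v] by fastforce
  qed
  then show ?thesis by (simp add: clarke_gradient_iff_slopes)
qed

text \<open>
  Since the base point of the difference quotient varies as well, the increment along \<open>v + w\<close> splits into an
  increment along \<open>v\<close> and one along \<open>w\<close> that starts at the shifted point \<open>y + h v\<close>.
\<close>

lemma clarke_deriv_add: "clarke_deriv J z (v + w) \<le> clarke_deriv J z v + clarke_deriv J z w"
proof (rule field_le_epsilon)
  fix e :: real assume "e > 0"
  then have lt: "clarke_deriv J z u < clarke_deriv J z u + e/2" for u by simp
  obtain d where d: "d > 0"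
    "\<forall>y h. dist y z < d \<longrightarrow> 0 < h \<longrightarrow> h < d \<longrightarrow> J (y + h *\<^sub>R v) - J y \<le> h * (clarke_deriv J z v + e/2)"
    using clarke_deriv_upper_bound[OF lt[of v]] by blast
  obtain d' where d': "d' > 0"
    "\<forall>y h. dist y z < d' \<longrightarrow> 0 < h \<longrightarrow> h < d' \<longrightarrow> J (y + h *\<^sub>R w) - J y \<le> h * (clarke_deriv J z w + e/2)"
    using clarke_deriv_upper_bound[OF lt[of w]] by blast
  define d'' where "d'' = min d d' / (1 + norm v)"
  have pos: "1 + norm v > 0" by (simp add: add_pos_nonneg)
  have dd: "d'' > 0" "d'' * (1 + norm v) = min d d'"
    using d d' pos by (auto simp: d''_def)
  have "d'' \<le> min d d'" using dd(2) mult_nonneg_nonneg[OF less_imp_le[OF dd(1)] norm_ge_zero[of v]]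
    by (simp only: distrib_left mult_1_right)
  have "clarke_deriv J z v + clarke_deriv J z w + e \<in> clarke_slopes J z (v + w)"
    unfolding clarke_slopes_def
  proof (intro CollectI exI[of _ d''] conjI allI impI dd(1))
    fix y h assume yh: "dist y z < d''" "0 < h" "h < d''"
    have "dist (y + h *\<^sub>R v) z \<le> dist y z + h * norm v"
      using norm_triangle_ineq[of "y - z" "h *\<^sub>R v"] yh by (simp add: dist_norm algebra_simps)
    also have "\<dots> < d'' + d'' * norm v"
      using yh by (intro add_less_le_mono mult_right_mono) auto
    finally have "dist (y + h *\<^sub>R v) z < d'" using dd by (simp add: algebra_simps)
    then have "J (y + h *\<^sub>R v + h *\<^sub>R w) - J (y + h *\<^sub>R v) \<le> h * (clarke_deriv J z w + e/2)"
      using d'(2)[rule_format] yh \<open>d'' \<le> min d d'\<close> by simp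
    moreover have "J (y + h *\<^sub>R v) - J y \<le> h * (clarke_deriv J z v + e/2)"
      using d(2)[rule_format] yh \<open>d'' \<le> min d d'\<close> by simp
    ultimately show "J (y + h *\<^sub>R (v + w)) - J y \<le> h * (clarke_deriv J z v + clarke_deriv J z w + e)"
      by (simp add: algebra_simps)
  qed
  then show "clarke_deriv J z (v + w) \<le> clarke_deriv J z v + clarke_deriv J z w + e"
    by (rule clarke_deriv_le)
qed

lemma clarke_deriv_scale:
  assumes "a > 0"
  shows "clarke_deriv J z (a *\<^sub>R v) = a * clarke_deriv J z v"
proof -
  have le: "clarke_deriv J z (a *\<^sub>R v) \<le> a * clarke_deriv J z v" if "a > 0" for a v
  proof (rule field_le_epsilon)
    fix e :: real assume "e > 0"
    then have "clarke_deriv J z v < clarke_deriv J z v + e/a" using that by simp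
    then obtain d where d: "d > 0"
      "\<forall>y h. dist y z < d \<longrightarrow> 0 < h \<longrightarrow> h < d \<longrightarrow> J (y + h *\<^sub>R v) - J y \<le> h * (clarke_deriv J z v + e/a)"
      using clarke_deriv_upper_bound[of v "clarke_deriv J z v + e/a"] by blast
    have "a * clarke_deriv J z v + e \<in> clarke_slopes J z (a *\<^sub>R v)"
      unfolding clarke_slopes_def
    proof (intro CollectI exI[of _ "min d (d/a)"] conjI allI impI)
      show "min d (d/a) > 0" using d that by simp
      fix y h assume yh: "dist y z < min d (d/a)" "0 < h" "h < min d (d/a)"
      then have "J (y + (h * a) *\<^sub>R v) - J y \<le> (h * a) * (clarke_deriv J z v + e/a)"
        using d(2)[rule_format, of y "h * a"] that by (simp add: field_simps)
      then show "J (y + h *\<^sub>R a *\<^sub>R v) - J y \<le> h * (a * clarke_deriv J z v + e)"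
        using that by (simp add: algebra_simps)
    qed
    then show "clarke_deriv J z (a *\<^sub>R v) \<le> a * clarke_deriv J z v + e"
      by (rule clarke_deriv_le)
  qed
  have "clarke_deriv J z ((1/a) *\<^sub>R (a *\<^sub>R v)) \<le> (1/a) * clarke_deriv J z (a *\<^sub>R v)"
    using assms by (intro le) simp
  then have "a * clarke_deriv J z v \<le> clarke_deriv J z (a *\<^sub>R v)"
    using assms by (simp add: field_simps)
  then show ?thesis using le[OF assms] by (simp add: antisym)
qed

lemma clarke_gradient_attains:
  obtains p where "p \<in> clarke_gradient J z" "p \<bullet> v = clarke_deriv J z v"
proof -
  obtain p where "p \<bullet> v = clarke_deriv J z v" "\<And>w. p \<bullet> w \<le> clarke_deriv J z w"
    using support_functional_sublinear[of "clarke_deriv J z" v, OF clarke_deriv_add clarke_deriv_scale]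
    by blast
  then show thesis by (intro that) (simp_all add: clarke_gradient_iff)
qed

text \<open>
  If the Clarke derivatives in the directions \<open>b\<close> and \<open>- b\<close> cancel, the difference quotients along \<open>b\<close> converge uniformly
  over all base points near \<open>z\<close>. Reaching \<open>z + v\<close> from \<open>z\<close> along the coordinate axes then adds up
  finitely many first-order expansions.
\<close>

lemma differentiable_if_clarke_deriv_odd:
  assumes odd: "\<And>b. b \<in> Basis \<Longrightarrow> clarke_deriv J z b + clarke_deriv J z (- b) = 0"
  shows "J differentiable (at z)"
proof -
  define s where "s b = clarke_deriv J z b" for b
  \<comment> \<open>The upper bound for the direction \<open>b\<close> at \<open>y\<close>, and the one for \<open>- b\<close> at the other end point \<open>y + h b\<close>.\<close>
  have coord: "\<exists>d>0. \<forall>y h. dist y z < d \<and> \<bar>h\<bar> < d \<longrightarrow> \<bar>J (y + h *\<^sub>R b) - J y - h * s b\<bar> \<le> e * \<bar>h\<bar>"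
    if "b \<in> Basis" "e > 0" for b e
  proof -
    have lt: "clarke_deriv J z b < s b + e" "clarke_deriv J z (- b) < - s b + e"
      using odd[OF that(1)] that(2) by (simp_all add: s_def)
    obtain d1 where d1: "d1 > 0"
      "\<forall>y h. dist y z < d1 \<longrightarrow> 0 < h \<longrightarrow> h < d1 \<longrightarrow> J (y + h *\<^sub>R b) - J y \<le> h * (s b + e)"
      using clarke_deriv_upper_bound[OF lt(1)] by blast
    obtain d2 where d2: "d2 > 0"
      "\<forall>y h. dist y z < d2 \<longrightarrow> 0 < h \<longrightarrow> h < d2 \<longrightarrow> J (y + h *\<^sub>R (- b)) - J y \<le> h * (- s b + e)"
      using clarke_deriv_upper_bound[OF lt(2)] by blast
    define d where "d = min d1 d2 / 2"
    have d: "d > 0" using d1 d2 by (simp add: d_def)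
    have pos: "\<bar>J (y + h *\<^sub>R b) - J y - h * s b\<bar> \<le> e * h" if "dist y z < 2 * d" "0 < h" "h < d"
      "dist (y + h *\<^sub>R b) z < 2 * d" for y h
    proof -
      have "J (y + h *\<^sub>R b) - J y \<le> h * (s b + e)" using d1(2)[rule_format, of y h] that by (simp add: d_def)
      moreover have "J ((y + h *\<^sub>R b) + h *\<^sub>R (- b)) - J (y + h *\<^sub>R b) \<le> h * (- s b + e)"
        using that by (intro d2(2)[rule_format]) (auto simp: d_def)
      ultimately show ?thesis by (simp add: algebra_simps abs_le_iff)
    qed
    have move: "dist (y + h *\<^sub>R b) z < 2 * d" if "dist y z < d" "\<bar>h\<bar> < d" for y h
    proof -
      have "dist (y + h *\<^sub>R b) z \<le> dist y z + \<bar>h\<bar>"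
        using norm_triangle_ineq[of "y - z" "h *\<^sub>R b"] \<open>b \<in> Basis\<close> by (simp add: dist_norm algebra_simps)
      then show ?thesis using that by simp
    qed
    have "\<bar>J (y + h *\<^sub>R b) - J y - h * s b\<bar> \<le> e * \<bar>h\<bar>" if "dist y z < d" "\<bar>h\<bar> < d" for y h
    proof (cases h "0::real" rule: linorder_cases)
      case less
      have "\<bar>J ((y + h *\<^sub>R b) + (-h) *\<^sub>R b) - J (y + h *\<^sub>R b) - (-h) * s b\<bar> \<le> e * (-h)"
        using that less move[OF that] by (intro pos) auto
      then show ?thesis using less by (simp add: abs_if algebra_simps split: if_splits)
    next
      case greater
      then show ?thesis using that move[OF that] pos[of y h] by simp
    qed simp
    then show ?thesis using d by blast
  qed
  \<comment> \<open>The estimate for walking along the axes in \<open>B\<close> only, in order to induct on \<open>B\<close>.\<close>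
  have tele: "\<exists>d>0. \<forall>v. norm v < d \<longrightarrow>
      \<bar>J (z + (\<Sum>b\<in>B. (v \<bullet> b) *\<^sub>R b)) - J z - (\<Sum>b\<in>B. (v \<bullet> b) * s b)\<bar> \<le> e * card B * norm v"
    if "finite B" "B \<subseteq> Basis" "e > 0" for B and e :: real
    using that(1,2)
  proof (induction B)
    case empty
    then show ?case by (auto intro: exI[of _ 1])
  next
    case (insert b B)
    then obtain d where d: "d > 0" "\<And>v. norm v < d \<Longrightarrow>
      \<bar>J (z + (\<Sum>b\<in>B. (v \<bullet> b) *\<^sub>R b)) - J z - (\<Sum>b\<in>B. (v \<bullet> b) * s b)\<bar> \<le> e * card B * norm v" by auto
    obtain d' where d': "d' > 0"
      "\<forall>y h. dist y z < d' \<longrightarrow> \<bar>h\<bar> < d' \<longrightarrow> \<bar>J (y + h *\<^sub>R b) - J y - h * s b\<bar> \<le> e * \<bar>h\<bar>"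
      using coord[of b e] insert.prems \<open>e > 0\<close> by auto
    define d'' where "d'' = min d (d' / (1 + card B))"
    have "d'' > 0" using d d' by (simp add: d''_def)
    moreover have "\<bar>J (z + (\<Sum>b\<in>insert b B. (v \<bullet> b) *\<^sub>R b)) - J z - (\<Sum>b\<in>insert b B. (v \<bullet> b) * s b)\<bar>
        \<le> e * card (insert b B) * norm v" if v: "norm v < d''" for v
    proof -
      define y where "y = z + (\<Sum>b\<in>B. (v \<bullet> b) *\<^sub>R b)"
      have vd: "norm v * (1 + card B) < d'"
        using v by (simp add: d''_def field_simps)
      have "norm (\<Sum>b\<in>B. (v \<bullet> b) *\<^sub>R b) \<le> (\<Sum>b\<in>B. norm v)"
        using insert.prems by (intro sum_norm_le) (auto simp: Basis_le_norm)
      then have "dist y z \<le> card B * norm v" by (simp add: y_def dist_norm)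
      moreover have "card B * norm v \<le> norm v * (1 + card B)" by (simp add: algebra_simps)
      ultimately have yz: "dist y z < d'" using vd by linarith
      have "norm v \<le> norm v * (1 + card B)" by (simp add: algebra_simps)
      moreover have vb: "\<bar>v \<bullet> b\<bar> \<le> norm v" using insert.prems by (simp add: Basis_le_norm)
      ultimately have "\<bar>v \<bullet> b\<bar> < d'" using vd by linarith
      then have 1: "\<bar>J (y + (v \<bullet> b) *\<^sub>R b) - J y - (v \<bullet> b) * s b\<bar> \<le> e * \<bar>v \<bullet> b\<bar>"
        using d'(2)[rule_format, OF yz] by blast
      have 2: "\<bar>J y - J z - (\<Sum>b\<in>B. (v \<bullet> b) * s b)\<bar> \<le> e * card B * norm v"
        using d(2) v unfolding y_def d''_def by simp
      have "e * \<bar>v \<bullet> b\<bar> \<le> e * norm v" using vb \<open>e > 0\<close> by simp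
      moreover have "z + (\<Sum>b\<in>insert b B. (v \<bullet> b) *\<^sub>R b) = y + (v \<bullet> b) *\<^sub>R b"
        using insert.hyps by (simp add: y_def algebra_simps)
      moreover have "(\<Sum>b\<in>insert b B. (v \<bullet> b) * s b) = (v \<bullet> b) * s b + (\<Sum>b\<in>B. (v \<bullet> b) * s b)"
        using insert.hyps by simp
      moreover have "e * card (insert b B) * norm v = e * card B * norm v + e * norm v"
        using insert.hyps by (simp add: algebra_simps)
      ultimately show ?thesis using 1 2 by (simp add: abs_le_iff)
    qed
    ultimately show ?case by blast
  qed
  define D where "D v = (\<Sum>b\<in>Basis. (v \<bullet> b) * s b)" for v :: 'a
  have "bounded_linear D" unfolding D_def
    by (intro bounded_linear_sum bounded_linear_mult_const bounded_linear_inner_left)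
  have "(J has_derivative D) (at z)"
    unfolding has_derivative_at_alt
  proof (intro conjI allI impI)
    fix e :: real assume "e > 0"
    then have "e / DIM('a) > 0" by simp
    from tele[OF finite_Basis order_refl this] obtain d where d: "d > 0" "\<And>v. norm v < d \<Longrightarrow>
      \<bar>J (z + (\<Sum>b\<in>Basis. (v \<bullet> b) *\<^sub>R b)) - J z - (\<Sum>b\<in>Basis. (v \<bullet> b) * s b)\<bar> \<le> e * norm v"
      by auto
    show "\<exists>d>0. \<forall>y. norm (y - z) < d \<longrightarrow> norm (J y - J z - D (y - z)) \<le> e * norm (y - z)"
      using d(1) d(2)[of "y - z" for y] by (intro exI[of _ d]) (auto simp: euclidean_representation D_def)
  qed fact
  then show ?thesis unfolding differentiable_def by blast
qed

section \<open>Points where the bidifferential is the Clarke gradient\<close>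

lemma eventually_along_ray:
  assumes "eventually P (at z within \<Omega>)" "v \<noteq> 0"
  shows "\<forall>\<^sub>F h in at_right (0::real). P (z + h *\<^sub>R v)"
proof -
  have lim: "((\<lambda>h. z + h *\<^sub>R v) \<longlongrightarrow> z) (at_right 0)"
    by (auto intro!: tendsto_eq_intros)
  have "\<forall>\<^sub>F h in at_right 0. z + h *\<^sub>R v \<in> interior \<Omega>"
    by (rule topological_tendstoD[OF lim open_interior z])
  moreover have "\<forall>\<^sub>F h in at_right (0::real). h > 0"
    by (rule eventually_at_right_less)
  ultimately have "\<forall>\<^sub>F h in at_right 0. z + h *\<^sub>R v \<in> \<Omega> \<and> z + h *\<^sub>R v \<noteq> z"
    by eventually_elim (use assms(2) interior_subset in auto)
  with lim have "filterlim (\<lambda>h. z + h *\<^sub>R v) (at z within \<Omega>) (at_right 0)"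
    by (simp add: filterlim_at)
  then show ?thesis using assms(1) by (rule eventually_compose_filterlim[rotated])
qed

lemma superdifferential_along_ray:
  assumes p: "p \<in> superdifferential \<Omega> J z" and e: "e > 0"
  shows "\<forall>\<^sub>F h in at_right 0. J (z + h *\<^sub>R v) - J z \<le> h * (p \<bullet> v + e)"
proof (cases "v = 0")
  case True
  have "\<forall>\<^sub>F h in at_right (0::real). h > 0"
    by (rule eventually_at_right_less)
  then show ?thesis by eventually_elim (use True e in simp)
next
  case False
  define e' where "e' = e / norm v"
  have e': "e' > 0" using e False by (simp add: e'_def)
  have "\<forall>\<^sub>F y in at z within \<Omega>. ereal ((J y - J z - p \<bullet> (y - z)) / norm (y - z)) < ereal e'"
    using p e' unfolding superdifferential_def mem_Collect_eq Limsup_le_iff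
    by (elim allE[of _ "ereal e'"]) simp
  then have "\<forall>\<^sub>F h in at_right 0. ereal ((J (z + h *\<^sub>R v) - J z - p \<bullet> (z + h *\<^sub>R v - z)) / norm (z + h *\<^sub>R v - z)) < ereal e'"
    by (rule eventually_along_ray[OF _ False])
  moreover have "\<forall>\<^sub>F h in at_right (0::real). h > 0"
    by (rule eventually_at_right_less)
  ultimately show ?thesis
  proof eventually_elim
    case (elim h)
    have pos: "norm (z + h *\<^sub>R v - z) > 0" and eq: "e' * norm (z + h *\<^sub>R v - z) = e * h"
      using elim False by (simp_all add: e'_def)
    show ?case
      using elim(1) unfolding less_ereal.simps pos_divide_less_eq[OF pos] pos_less_divide_eq[OF pos] mult_minus_left eq
      by (simp add: algebra_simps)
  qed
qed

lemma subdifferential_along_ray: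
  assumes p: "p \<in> subdifferential \<Omega> J z" and e: "e > 0"
  shows "\<forall>\<^sub>F h in at_right 0. h * (p \<bullet> v - e) \<le> J (z + h *\<^sub>R v) - J z"
proof (cases "v = 0")
  case True
  have "\<forall>\<^sub>F h in at_right (0::real). h > 0"
    by (rule eventually_at_right_less)
  then show ?thesis by eventually_elim (use True e in simp)
next
  case False
  define e' where "e' = e / norm v"
  have e': "e' > 0" using e False by (simp add: e'_def)
  have "\<forall>\<^sub>F y in at z within \<Omega>. ereal (- e') < ereal ((J y - J z - p \<bullet> (y - z)) / norm (y - z))"
    using p e' unfolding subdifferential_def mem_Collect_eq le_Liminf_iff
    by (elim allE[of _ "ereal (- e')"]) simp
  then have "\<forall>\<^sub>F h in at_right 0. ereal (- e') < ereal ((J (z + h *\<^sub>R v) - J z - p \<bullet> (z + h *\<^sub>R v - z)) / norm (z + h *\<^sub>R v - z))"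
    by (rule eventually_along_ray[OF _ False])
  moreover have "\<forall>\<^sub>F h in at_right (0::real). h > 0"
    by (rule eventually_at_right_less)
  ultimately show ?thesis
  proof eventually_elim
    case (elim h)
    have pos: "norm (z + h *\<^sub>R v - z) > 0" and eq: "e' * norm (z + h *\<^sub>R v - z) = e * h"
      using elim False by (simp_all add: e'_def)
    show ?case
      using elim(1) unfolding less_ereal.simps pos_divide_less_eq[OF pos] pos_less_divide_eq[OF pos] mult_minus_left eq
      by (simp add: algebra_simps)
  qed
qed

text \<open>
  Along \<open>v = q - p\<close> the two linear bounds give \<open>q \<bullet> v \<le> p \<bullet> v\<close>, that is \<open>v \<bullet> v \<le> 0\<close>.
\<close>

lemma super_sub_differential_unique:
  assumes p: "p \<in> superdifferential \<Omega> J z" and q: "q \<in> subdifferential \<Omega> J z"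
  shows "p = q"
proof (rule ccontr)
  assume "p \<noteq> q"
  define v where "v = q - p"
  have v: "q \<bullet> v - p \<bullet> v = v \<bullet> v" "v \<bullet> v > 0"
    using \<open>p \<noteq> q\<close> inner_gt_zero_iff[of v] by (simp_all only: v_def inner_diff_left) simp
  define e where "e = v \<bullet> v / 4"
  have e: "e > 0" using v by (simp add: e_def)
  have "\<forall>\<^sub>F h in at_right (0::real). False"
    using superdifferential_along_ray[OF p e, of v] subdifferential_along_ray[OF q e, of v]
      eventually_at_right_less[of 0]
  proof eventually_elim
    case (elim h)
    then have "h * (q \<bullet> v - e) \<le> h * (p \<bullet> v + e)" by linarith
    then have "q \<bullet> v - e \<le> p \<bullet> v + e" using elim by (simp only: mult_le_cancel_left_pos)
    then show ?case using v e_def by linarith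
  qed
  then show False by simp
qed

text \<open>
  The Clarke derivative bounds the upper difference quotients at \<open>z\<close>. If the Clarke gradient consists of
  subgradients, the one that attains the Clarke derivative in the direction \<open>v\<close> bounds the lower quotients by the
  same number. If it consists of supergradients, the same argument works in the direction \<open>- v\<close> with the inequalities
  reversed. No third case exists because super- and subdifferential cannot both be nonempty without being the
  same singleton.
\<close>

lemma clarke_regular_dir_deriv:
  assumes eq: "bidifferential \<Omega> J z = clarke_gradient J z"
  shows "(\<forall>v. has_dir_deriv J z v (clarke_deriv J z v)) \<or>
         (\<forall>v. has_dir_deriv J z v (- clarke_deriv J z (- v)))"
proof -
  have upper: "\<forall>\<^sub>F h in at_right 0. J (z + h *\<^sub>R v) - J z \<le> h * (clarke_deriv J z v + e)"
    if "e > 0" for v e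
  proof -
    obtain d where "d > 0"
      "\<forall>y h. dist y z < d \<longrightarrow> 0 < h \<longrightarrow> h < d \<longrightarrow> J (y + h *\<^sub>R v) - J y \<le> h * (clarke_deriv J z v + e)"
      using clarke_deriv_upper_bound[of v "clarke_deriv J z v + e"] \<open>e > 0\<close> by force
    then show ?thesis unfolding eventually_at_right_field by (intro exI[of _ d]) auto
  qed
  have lower: "\<forall>\<^sub>F h in at_right 0. h * (- clarke_deriv J z (- v) - e) \<le> J (z + h *\<^sub>R v) - J z"
    if "e > 0" for v e
  proof -
    obtain d where d: "d > 0"
      "\<forall>y h. dist y z < d \<longrightarrow> 0 < h \<longrightarrow> h < d \<longrightarrow> J (y + h *\<^sub>R (- v)) - J y \<le> h * (clarke_deriv J z (- v) + e)"
      using clarke_deriv_upper_bound[of "- v" "clarke_deriv J z (- v) + e"] \<open>e > 0\<close> by force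
    have "((\<lambda>h. z + h *\<^sub>R v) \<longlongrightarrow> z) (at_right 0)"
      by (auto intro!: tendsto_eq_intros)
    from tendstoD[OF this d(1)] have "\<forall>\<^sub>F h in at_right 0. dist (z + h *\<^sub>R v) z < d" .
    moreover have "\<forall>\<^sub>F h in at_right 0. 0 < h \<and> h < d"
      unfolding eventually_at_right_field using d(1) by auto
    ultimately show ?thesis
    proof eventually_elim
      case (elim h)
      \<comment> \<open>The base point \<open>z + h v\<close> lets the bound for the direction \<open>- v\<close> lead back to \<open>z\<close>.\<close>
      then show ?case using d(2)[rule_format, of "z + h *\<^sub>R v" h] by (simp add: algebra_simps)
    qed
  qed
  show ?thesis
  proof (cases "clarke_gradient J z \<subseteq> subdifferential \<Omega> J z")
    case True
    have "has_dir_deriv J z v (clarke_deriv J z v)" for v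
    proof (rule has_dir_derivI)
      fix e :: real assume "e > 0"
      then show "\<forall>\<^sub>F h in at_right 0. J (z + h *\<^sub>R v) - J z \<le> h * (clarke_deriv J z v + e)"
        by (rule upper)
      obtain p where "p \<in> clarke_gradient J z" "p \<bullet> v = clarke_deriv J z v"
        by (rule clarke_gradient_attains)
      then show "\<forall>\<^sub>F h in at_right 0. h * (clarke_deriv J z v - e) \<le> J (z + h *\<^sub>R v) - J z"
        using subdifferential_along_ray[of p e v] True \<open>e > 0\<close> by auto
    qed
    then show ?thesis by blast
  next
    case False
    then obtain p where p: "p \<in> superdifferential \<Omega> J z" "p \<notin> subdifferential \<Omega> J z"
      using eq unfolding bidifferential_def by blast
    then have "subdifferential \<Omega> J z = {}" using super_sub_differential_unique by blast
    then have super: "clarke_gradient J z \<subseteq> superdifferential \<Omega> J z"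
      using eq unfolding bidifferential_def by blast
    have "has_dir_deriv J z v (- clarke_deriv J z (- v))" for v
    proof (rule has_dir_derivI)
      fix e :: real assume "e > 0"
      then show "\<forall>\<^sub>F h in at_right 0. h * (- clarke_deriv J z (- v) - e) \<le> J (z + h *\<^sub>R v) - J z"
        by (rule lower)
      obtain q where q: "q \<in> clarke_gradient J z" "q \<bullet> (- v) = clarke_deriv J z (- v)"
        by (rule clarke_gradient_attains)
      then have "q \<bullet> v = - clarke_deriv J z (- v)" by simp
      then show "\<forall>\<^sub>F h in at_right 0. J (z + h *\<^sub>R v) - J z \<le> h * (- clarke_deriv J z (- v) + e)"
        using superdifferential_along_ray[of q e v] super q(1) \<open>e > 0\<close> by auto
    qed
    then show ?thesis by blast
  qed
qed

lemma clarke_regular_has_dir_deriv: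
  assumes "bidifferential \<Omega> J z = clarke_gradient J z"
  obtains l where "has_dir_deriv J z v l"
  using clarke_regular_dir_deriv[OF assms] by blast

text \<open>
  In both cases of \<open>clarke_regular_dir_deriv\<close> the equality of the two one-sided derivatives along \<open>b\<close> says that
  the Clarke derivatives in the directions \<open>b\<close> and \<open>- b\<close> cancel.
\<close>

lemma clarke_regular_differentiable:
  assumes "bidifferential \<Omega> J z = clarke_gradient J z"
    and "\<And>b l r. b \<in> Basis \<Longrightarrow> has_dir_deriv J z b r \<Longrightarrow> has_dir_deriv J z (- b) l \<Longrightarrow> r = - l"
  shows "J differentiable (at z)"
proof (rule differentiable_if_clarke_deriv_odd)
  fix b :: 'a assume b: "b \<in> Basis"
  from clarke_regular_dir_deriv[OF assms(1)]
  show "clarke_deriv J z b + clarke_deriv J z (- b) = 0"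
  proof
    assume "\<forall>v. has_dir_deriv J z v (clarke_deriv J z v)"
    then show ?thesis using assms(2)[OF b, of "clarke_deriv J z b" "clarke_deriv J z (- b)"] by simp
  next
    assume R: "\<forall>v. has_dir_deriv J z v (- clarke_deriv J z (- v))"
    show ?thesis
      using assms(2)[OF b, of "- clarke_deriv J z (- b)" "- clarke_deriv J z b"]
        R[rule_format, of b] R[rule_format, of "- b"] by simp
  qed
qed

end

section \<open>Absolutely continuous functions\<close>

lemma AE_lebesgue_on_iff_negligible:
  assumes "S \<in> sets lebesgue"
  shows "(AE t in lebesgue_on S. P t) \<longleftrightarrow> (\<exists>N. negligible N \<and> (\<forall>t\<in>S - N. P t))"
proof -
  have "(AE t in lebesgue_on S. P t) \<longleftrightarrow> (AE t in lebesgue. t \<in> S \<longrightarrow> P t)"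
    using assms by (subst AE_restrict_space_iff) auto
  also have "\<dots> \<longleftrightarrow> (\<exists>N. negligible N \<and> {t. \<not> (t \<in> S \<longrightarrow> P t)} \<subseteq> N)"
    by (rule eventually_ae_filter_negligible)
  also have "\<dots> \<longleftrightarrow> (\<exists>N. negligible N \<and> (\<forall>t\<in>S - N. P t))"
    by (intro iff_exI conj_cong refl) auto
  finally show ?thesis .
qed

text \<open>
  The gauge is chosen from the derivative at tags outside \<open>N\<close>, as in the classical fundamental theorem for the
  gauge integral. At tags in \<open>N\<close> it forces the intervals into an open set \<open>V \<supseteq> N\<close> of measure
  below the \<open>\<delta>\<close> of absolute continuity, so those intervals contribute little.
\<close>

lemma fundamental_theorem_of_calculus_absolutely_continuous:
  fixes \<phi> :: "real \<Rightarrow> 'a::banach"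
  assumes "a \<le> b" and ac: "absolutely_continuous_on {a..b} \<phi>" and N: "negligible N"
    and deriv: "\<And>t. t \<in> {a..b} - N \<Longrightarrow> (\<phi> has_vector_derivative \<phi>' t) (at t within {a..b})"
  shows "(\<phi>' has_integral (\<phi> b - \<phi> a)) {a..b}"
proof -
  define F where "F t = (if t \<in> N then 0 else \<phi>' t)" for t
  have "(F has_integral (\<phi> b - \<phi> a)) (cbox a b)"
    unfolding has_integral
  proof (intro allI impI)
    fix e :: real assume "e > 0"
    define w where "w = b - a + 1"
    define e1 where "e1 = e / (2 * w)"
    have e1: "e1 > 0" "e1 * (b - a) < e / 2"
    proof -
      have w: "w > 0" using \<open>a \<le> b\<close> by (simp add: w_def)
      then show "e1 > 0" using \<open>e > 0\<close> by (simp add: e1_def)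
      then have "e1 * (b - a) < e1 * w" by (simp add: w_def)
      also have "\<dots> = e / 2" using w by (simp add: e1_def)
      finally show "e1 * (b - a) < e / 2" .
    qed
    from ac \<open>e > 0\<close> obtain \<delta> where "\<delta> > 0" and \<delta>: "\<And>D E. D division_of E \<Longrightarrow> E \<subseteq> {a..b} \<Longrightarrow>
        (\<Sum>k\<in>D. Sup k - Inf k) < \<delta> \<Longrightarrow> (\<Sum>k\<in>D. norm (\<phi> (Sup k) - \<phi> (Inf k))) < e / 2"
      unfolding absolutely_continuous_on_def using half_gt_zero by meson
    have "N \<in> sets lebesgue" using N by (simp add: negligible_imp_sets)
    from sets_lebesgue_outer_open[OF this \<open>\<delta> > 0\<close>]
    obtain V where V: "open V" "N \<subseteq> V" "V - N \<in> lmeasurable" "emeasure lebesgue (V - N) < ennreal \<delta>" .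
    have "measure lebesgue (V - N) < \<delta>"
      using V(3,4) \<open>\<delta> > 0\<close> by (simp add: emeasure_eq_measure2 ennreal_less_iff)
    moreover have VN: "(V - N) \<union> N = V" using V by blast
    moreover have "(V - N) \<union> N \<in> lmeasurable"
      by (rule fmeasurable.Un[OF V(3) negligible_imp_measurable[OF N]])
    moreover have "measure lebesgue ((V - N) \<union> N) = measure lebesgue (V - N)"
      using V(3) N by (intro measure_Un_null_set) (auto simp: negligible_iff_null_sets)
    ultimately have mV: "V \<in> lmeasurable" "measure lebesgue V < \<delta>" by simp_all
    have "\<exists>d>0. (t \<in> N \<longrightarrow> ball t d \<subseteq> V) \<and> (t \<in> {a..b} - N \<longrightarrow>
        (\<forall>y\<in>{a..b}. norm (y - t) < d \<longrightarrow> norm (\<phi> y - \<phi> t - (y - t) *\<^sub>R \<phi>' t) \<le> e1 * norm (y - t)))" for t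
    proof (cases "t \<in> N")
      case True
      then show ?thesis using V openE by blast
    next
      case False
      show ?thesis
      proof (cases "t \<in> {a..b}")
        case True
        then show ?thesis
          using deriv[of t] False e1(1)
          unfolding has_vector_derivative_def has_derivative_within_alt by blast
      next
        case False
        then show ?thesis using \<open>t \<notin> N\<close> by (intro exI[of _ 1]) auto
      qed
    qed
    then obtain d where d0: "\<And>t. d t > 0" and dN: "\<And>t. t \<in> N \<Longrightarrow> ball t (d t) \<subseteq> V"
      and d: "\<And>t y. t \<in> {a..b} - N \<Longrightarrow> y \<in> {a..b} \<Longrightarrow> norm (y - t) < d t \<Longrightarrow>
         norm (\<phi> y - \<phi> t - (y - t) *\<^sub>R \<phi>' t) \<le> e1 * norm (y - t)"
      by metis
    show "\<exists>\<gamma>. gauge \<gamma> \<and> (\<forall>p. p tagged_division_of (cbox a b) \<and> \<gamma> fine p \<longrightarrow>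
        norm ((\<Sum>(x, k)\<in>p. measure lborel k *\<^sub>R F x) - (\<phi> b - \<phi> a)) < e)"
    proof (intro exI[of _ "\<lambda>t. ball t (d t)"] conjI allI impI)
      show "gauge (\<lambda>t. ball t (d t))" using d0 by (rule gauge_ball_dependent[rule_format])
      fix p assume p: "p tagged_division_of (cbox a b) \<and> (\<lambda>t. ball t (d t)) fine p"
      note td = tagged_division_ofD[OF conjunct1[OF p]]
      \<comment> \<open>\<open>q\<close> collects the tagged intervals on which the derivative says nothing.\<close>
      define q where "q = {(x, k) \<in> p. x \<in> N}"
      have q: "q \<subseteq> p" by (auto simp: q_def)
      define G where "G = (\<lambda>(x, k). measure lborel k *\<^sub>R F x - (\<phi> (Sup k) - \<phi> (Inf k)))"
      have iv: "\<exists>u v. k = {u..v} \<and> u \<le> x \<and> x \<le> v \<and> a \<le> u \<and> v \<le> b \<and> Inf k = u \<and> Sup k = v \<and>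
          measure lborel k = v - u \<and> {u..v} \<subseteq> ball x (d x)" if xk: "(x, k) \<in> p" for x k
      proof -
        obtain u v where k: "k = {u..v}" using td(4)[OF xk] by auto
        have "x \<in> {u..v}" "{u..v} \<subseteq> {a..b}" using td(2,3)[OF xk] k by auto
        moreover have "{u..v} \<subseteq> ball x (d x)" using p xk k by (auto dest: fineD)
        ultimately show ?thesis using k by (intro exI[of _ u] exI[of _ v]) auto
      qed
      have sum1: "(\<Sum>(x, k)\<in>p. Sup k - Inf k) = b - a"
        using additive_tagged_division_1[OF \<open>a \<le> b\<close>, of p "\<lambda>x. x"] p by simp
      have "(\<Sum>(x, k)\<in>p. measure lborel k *\<^sub>R F x) - (\<phi> b - \<phi> a) = (\<Sum>w\<in>p. G w)"
        using additive_tagged_division_1[OF \<open>a \<le> b\<close>, of p \<phi>] p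
        by (simp add: G_def split_def sum_subtractf)
      also have "\<dots> = (\<Sum>w\<in>p - q. G w) + (\<Sum>w\<in>q. G w)"
        using sum.subset_diff[OF q td(1)] .
      finally have split: "norm ((\<Sum>(x, k)\<in>p. measure lborel k *\<^sub>R F x) - (\<phi> b - \<phi> a))
          \<le> norm (\<Sum>w\<in>p - q. G w) + norm (\<Sum>w\<in>q. G w)"
        by (simp add: norm_triangle_ineq)
      have "norm (\<Sum>w\<in>p - q. G w) \<le> (\<Sum>w\<in>p - q. e1 * (case w of (x, k) \<Rightarrow> Sup k - Inf k))"
      proof (rule sum_norm_le, safe)
        fix x k assume xk: "(x, k) \<in> p" "(x, k) \<notin> q"
        then have xN: "x \<notin> N" by (simp add: q_def)
        obtain u v where k: "k = {u..v}" "u \<le> x" "x \<le> v" "a \<le> u" "v \<le> b" "Inf k = u" "Sup k = v"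
          "measure lborel k = v - u" "{u..v} \<subseteq> ball x (d x)" using iv[OF xk(1)] by blast
        have uv: "u \<in> ball x (d x)" "v \<in> ball x (d x)" using subsetD[OF k(9)] k(2,3) by (simp_all del: mem_ball)
        have "norm (\<phi> u - \<phi> x - (u - x) *\<^sub>R \<phi>' x) \<le> e1 * norm (u - x)"
          using xN k uv by (intro d) (auto simp: dist_real_def)
        moreover have "norm (\<phi> v - \<phi> x - (v - x) *\<^sub>R \<phi>' x) \<le> e1 * norm (v - x)"
          using xN k uv by (intro d) (auto simp: dist_real_def)
        moreover have "G (x, k) = (\<phi> u - \<phi> x - (u - x) *\<^sub>R \<phi>' x) - (\<phi> v - \<phi> x - (v - x) *\<^sub>R \<phi>' x)"
          using xN k by (simp add: G_def F_def algebra_simps)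
        ultimately have "norm (G (x, k)) \<le> e1 * norm (u - x) + e1 * norm (v - x)"
          by (metis (no_types, lifting) add_mono norm_triangle_ineq4 order_trans)
        also have "\<dots> = e1 * (Sup k - Inf k)" using k by (simp add: algebra_simps)
        finally show "norm (G (x, k)) \<le> e1 * (Sup k - Inf k)" .
      qed
      also have "\<dots> \<le> (\<Sum>w\<in>p. e1 * (case w of (x, k) \<Rightarrow> Sup k - Inf k))"
      proof (rule sum_mono2[OF td(1)])
        fix w assume "w \<in> p - (p - q)"
        then obtain x k where w: "w = (x, k)" "(x, k) \<in> p" by (cases w) auto
        have "Inf k \<le> Sup k" using iv[OF w(2)] by auto
        then show "0 \<le> e1 * (case w of (x, k) \<Rightarrow> Sup k - Inf k)" using e1(1) w(1) by simp
      qed blast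
      also have "\<dots> = e1 * (b - a)"
        using sum1 by (simp add: sum_distrib_left[symmetric])
      finally have part1: "norm (\<Sum>w\<in>p - q. G w) < e / 2" using e1 by linarith
      have ptq: "q tagged_partial_division_of cbox a b"
        using tagged_partial_division_subset[OF _ q] p by (auto simp: tagged_division_of_def)
      note div = partial_division_of_tagged_division[OF ptq]
      have D_iv: "k \<noteq> {} \<and> Inf k \<le> Sup k \<and> measure lebesgue k = Sup k - Inf k \<and> k \<subseteq> {a..b} \<and> k \<subseteq> V"
        if kq: "k \<in> snd ` q" for k
      proof -
        obtain x where x: "(x, k) \<in> p" "x \<in> N" using kq by (auto simp: q_def)
        obtain u v where "k = {u..v}" "u \<le> x" "x \<le> v" "a \<le> u" "v \<le> b" "Inf k = u" "Sup k = v"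
          "measure lborel k = v - u" "{u..v} \<subseteq> ball x (d x)" using iv[OF x(1)] by blast
        then show ?thesis using dN[OF x(2)] by auto
      qed
      have "(\<Sum>k\<in>snd ` q. Sup k - Inf k) = (\<Sum>k\<in>snd ` q. measure lebesgue k)"
        using D_iv by (intro sum.cong) auto
      also have "\<dots> = measure lebesgue (\<Union>(snd ` q))"
        by (rule content_division[OF div])
      also have "\<dots> \<le> measure lebesgue V"
        using D_iv mV lmeasurable_division[OF div] by (intro measure_mono_fmeasurable) auto
      finally have "(\<Sum>k\<in>snd ` q. Sup k - Inf k) < \<delta>" using mV by linarith
      moreover have "\<Union>(snd ` q) \<subseteq> {a..b}" using D_iv by blast
      ultimately have small: "(\<Sum>k\<in>snd ` q. norm (\<phi> (Sup k) - \<phi> (Inf k))) < e / 2"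
        using \<delta>[OF div] by blast
      define H where "H k = (if k = {} then 0 else norm (\<phi> (Sup k) - \<phi> (Inf k)))" for k
      have "norm (\<Sum>w\<in>q. G w) \<le> (\<Sum>(x, k)\<in>q. H k)"
      proof (rule sum_norm_le, safe)
        fix x k assume "(x, k) \<in> q"
        moreover from this have "k \<noteq> {}" using D_iv by force
        ultimately show "norm (G (x, k)) \<le> H k"
          by (simp add: q_def G_def F_def H_def norm_minus_commute)
      qed
      also have "\<dots> = (\<Sum>k\<in>snd ` q. H k)"
      proof (rule sum.over_tagged_division_lemma[OF tagged_partial_division_of_Union_self[OF ptq]])
        fix u v :: real assume "box u v = {}"
        then have "cbox u v = {} \<or> u = v" by auto
        then show "H (cbox u v) = 0" by (auto simp: H_def)
      qed
      also have "\<dots> = (\<Sum>k\<in>snd ` q. norm (\<phi> (Sup k) - \<phi> (Inf k)))"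
        using D_iv by (intro sum.cong) (auto simp: H_def)
      finally have "norm (\<Sum>w\<in>q. G w) < e / 2" using small by linarith
      then show "norm ((\<Sum>(x, k)\<in>p. measure lborel k *\<^sub>R F x) - (\<phi> b - \<phi> a)) < e"
        using split part1 by linarith
    qed
  qed
  then show ?thesis
    using has_integral_spike[OF N, of "{a..b}" \<phi>' F "\<phi> b - \<phi> a"] by (simp add: F_def)
qed

lemma absolutely_continuous_on_subset:
  "absolutely_continuous_on S \<phi> \<Longrightarrow> R \<subseteq> S \<Longrightarrow> absolutely_continuous_on R \<phi>"
  unfolding absolutely_continuous_on_def by (meson order_trans)

text \<open>
  Covers Lipschitz functions of \<open>t\<close> (\<open>M = 0\<close>), Lipschitz images \<open>t \<mapsto> J (t, y t)\<close> of absolutely continuous curves, and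
  changes of sign.
\<close>

lemma absolutely_continuous_on_dominated:
  fixes \<phi> :: "real \<Rightarrow> 'a::real_normed_vector" and y :: "real \<Rightarrow> 'b::real_normed_vector"
  assumes ac: "absolutely_continuous_on S y" and LM: "L \<ge> 0" "M \<ge> 0"
    and dom: "\<And>s t. s \<in> S \<Longrightarrow> t \<in> S \<Longrightarrow> norm (\<phi> t - \<phi> s) \<le> L * \<bar>t - s\<bar> + M * norm (y t - y s)"
  shows "absolutely_continuous_on S \<phi>"
  unfolding absolutely_continuous_on_def
proof (intro allI impI)
  fix e :: real assume "e > 0"
  define e1 where "e1 = e / (2 * (M + 1))"
  have e1: "e1 > 0" "M * e1 \<le> e / 2"
    using \<open>e > 0\<close> LM by (auto simp: e1_def field_simps)
  obtain \<delta> where "\<delta> > 0" and \<delta>: "\<And>D E. D division_of E \<Longrightarrow> E \<subseteq> S \<Longrightarrow>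
        (\<Sum>k\<in>D. Sup k - Inf k) < \<delta> \<Longrightarrow> (\<Sum>k\<in>D. norm (y (Sup k) - y (Inf k))) < e1"
    using ac e1(1) unfolding absolutely_continuous_on_def by meson
  define e2 where "e2 = e / (2 * (L + 1))"
  have e2: "e2 > 0" "L * e2 < e / 2"
    using \<open>e > 0\<close> LM by (auto simp: e2_def field_simps)
  show "\<exists>\<delta>>0. \<forall>D E. D division_of E \<and> E \<subseteq> S \<and> (\<Sum>k\<in>D. Sup k - Inf k) < \<delta> \<longrightarrow>
        (\<Sum>k\<in>D. norm (\<phi> (Sup k) - \<phi> (Inf k))) < e"
  proof (intro exI[of _ "min \<delta> e2"] conjI allI impI)
    show "min \<delta> e2 > 0" using \<open>\<delta> > 0\<close> e2 by simp
    fix D E assume DE: "D division_of E \<and> E \<subseteq> S \<and> (\<Sum>k\<in>D. Sup k - Inf k) < min \<delta> e2"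
    have pt: "norm (\<phi> (Sup k) - \<phi> (Inf k)) \<le> L * (Sup k - Inf k) + M * norm (y (Sup k) - y (Inf k))"
      if kD: "k \<in> D" for k
    proof -
      obtain u v where k: "k = {u..v}" using division_ofD(4)[OF conjunct1[OF DE] kD] by auto
      have "u \<le> v" "k \<subseteq> S" using division_ofD(2,3)[OF conjunct1[OF DE] kD] DE k by auto
      then have "u \<in> S" "v \<in> S" "Inf k = u" "Sup k = v" using k by auto
      then show ?thesis using dom[of u v] \<open>u \<le> v\<close> by simp
    qed
    have "(\<Sum>k\<in>D. norm (\<phi> (Sup k) - \<phi> (Inf k))) \<le>
        (\<Sum>k\<in>D. L * (Sup k - Inf k) + M * norm (y (Sup k) - y (Inf k)))"
      using pt by (rule sum_mono)
    also have "\<dots> = L * (\<Sum>k\<in>D. Sup k - Inf k) + M * (\<Sum>k\<in>D. norm (y (Sup k) - y (Inf k)))"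
      by (simp add: sum.distrib sum_distrib_left)
    also have "\<dots> \<le> L * e2 + M * e1"
      using DE \<delta>[of D E] LM by (intro add_mono mult_left_mono) auto
    also have "\<dots> < e" using e1 e2 by linarith
    finally show "(\<Sum>k\<in>D. norm (\<phi> (Sup k) - \<phi> (Inf k))) < e" .
  qed
qed

lemma lipschitz_imp_absolutely_continuous_on:
  fixes \<phi> :: "real \<Rightarrow> 'a::real_normed_vector"
  assumes "L-lipschitz_on S \<phi>"
  shows "absolutely_continuous_on S \<phi>"
proof (rule absolutely_continuous_on_dominated[where y = "\<lambda>_. 0::real" and M = 0 and L = L])
  show "absolutely_continuous_on S (\<lambda>_. 0::real)"
    by (auto simp: absolutely_continuous_on_def intro: exI[of _ 1])
  show "L \<ge> 0" using assms by (rule lipschitz_on_nonneg)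
  show "norm (\<phi> t - \<phi> s) \<le> L * \<bar>t - s\<bar> + 0 * norm (0 - (0::real))" if "s \<in> S" "t \<in> S" for s t
    using lipschitz_onD[OF assms that(2,1)] by (simp add: dist_norm)
qed auto

lemma absolutely_continuous_on_imp_continuous_on:
  assumes ac: "absolutely_continuous_on {a..b} x"
  shows "continuous_on {a..b} x"
  unfolding continuous_on_iff
proof (intro ballI allI impI)
  fix s and e :: real assume s: "s \<in> {a..b}" and "e > 0"
  obtain \<delta> where "\<delta> > 0" and \<delta>: "\<And>D E. D division_of E \<Longrightarrow> E \<subseteq> {a..b} \<Longrightarrow>
        (\<Sum>k\<in>D. Sup k - Inf k) < \<delta> \<Longrightarrow> (\<Sum>k\<in>D. norm (x (Sup k) - x (Inf k))) < e"
    using ac \<open>e > 0\<close> unfolding absolutely_continuous_on_def by meson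
  have "dist (x t) (x s) < e" if t: "t \<in> {a..b}" "dist t s < \<delta>" for t
  proof -
    define u v where "u = min s t" and "v = max s t"
    have uv: "u \<le> v" "{u..v} \<subseteq> {a..b}" "v - u < \<delta>" using s t by (auto simp: u_def v_def dist_real_def)
    have "{{u..v}} division_of {u..v}" using division_of_self[of u v] uv by simp
    from \<delta>[OF this uv(2)] have "norm (x v - x u) < e" using uv by simp
    then show ?thesis by (auto simp: u_def v_def dist_norm norm_minus_commute min_def max_def split: if_splits)
  qed
  then show "\<exists>d>0. \<forall>t\<in>{a..b}. dist t s < d \<longrightarrow> dist (x t) (x s) < e"
    using \<open>\<delta> > 0\<close> by blast
qed

lemma absolutely_continuous_increment_ge:
  fixes \<phi> m :: "real \<Rightarrow> real"
  assumes "a \<le> b" "absolutely_continuous_on {a..b} \<phi>" and m: "(m has_integral I) {a..b}"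
    and deriv: "AE t in lebesgue_on {a..b}. \<exists>D. (\<phi> has_real_derivative D) (at t within {a..b}) \<and> m t \<le> D"
  shows "I \<le> \<phi> b - \<phi> a"
proof -
  obtain N where N: "negligible N"
    "\<forall>t\<in>{a..b} - N. \<exists>D. (\<phi> has_real_derivative D) (at t within {a..b}) \<and> m t \<le> D"
    using deriv AE_lebesgue_on_iff_negligible[of "{a..b}"] by auto
  then obtain \<phi>' where \<phi>': "\<forall>t\<in>{a..b} - N. (\<phi> has_real_derivative \<phi>' t) (at t within {a..b}) \<and> m t \<le> \<phi>' t"
    by metis
  have int: "(\<phi>' has_integral (\<phi> b - \<phi> a)) {a..b}"
    using \<phi>' by (intro fundamental_theorem_of_calculus_absolutely_continuous[OF assms(1,2) N(1)])
      (simp add: has_real_derivative_iff_has_vector_derivative)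
  have "((\<lambda>t. if t \<in> N then \<phi>' t else m t) has_integral I) {a..b}"
    using has_integral_spike[OF N(1) _ m] by simp
  then show ?thesis using int \<phi>' by (elim has_integral_le) auto
qed

text \<open>
  The right-hand side \<open>\<Theta>\<close> is differentiable with \<open>\<Theta>' = b \<theta> \<le> b \<Theta>\<close>, hence \<open>exp (- b s) \<Theta> s\<close> decreases.
\<close>

lemma gronwall:
  fixes \<theta> :: "real \<Rightarrow> real"
  assumes cont: "continuous_on {0..T} \<theta>" and "b \<ge> 0"
    and le: "\<And>t. t \<in> {0..T} \<Longrightarrow> \<theta> t \<le> C + b * integral {0..t} \<theta>"
    and t: "t \<in> {0..T}"
  shows "\<theta> t \<le> C * exp (b * t)"
proof -
  define \<Theta> where "\<Theta> s = C + b * integral {0..s} \<theta>" for s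
  have d: "(\<Theta> has_real_derivative b * \<theta> s) (at s within {0..T})" if "s \<in> {0..T}" for s
    unfolding \<Theta>_def
    using integral_has_real_derivative[OF cont that] by (auto intro!: derivative_eq_intros)
  have d2: "((\<lambda>s. exp (- (b * s)) * \<Theta> s) has_real_derivative exp (- (b * s)) * (b * \<theta> s - b * \<Theta> s)) (at s within {0..T})"
    if "s \<in> {0..T}" for s
    using d[OF that] by (auto intro!: derivative_eq_intros simp: algebra_simps)
  have "exp (- (b * t)) * \<Theta> t \<le> exp (- (b * 0)) * \<Theta> 0"
  proof (rule DERIV_nonpos_imp_decreasing_open[where f = "\<lambda>s. exp (- (b * s)) * \<Theta> s" and a = 0 and b = t])
    show "0 \<le> t" using t by simp
    have "continuous_on {0..T} (\<lambda>s. exp (- (b * s)) * \<Theta> s)"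
      using d2 by (rule DERIV_continuous_on)
    then show "continuous_on {0..t} (\<lambda>s. exp (- (b * s)) * \<Theta> s)"
      by (rule continuous_on_subset) (use t in auto)
    fix s assume s: "0 < s" "s < t"
    have "exp (- (b * s)) * (b * \<theta> s - b * \<Theta> s) \<le> 0"
      using le[of s] s t \<open>b \<ge> 0\<close> unfolding \<Theta>_def
      by (intro mult_nonneg_nonpos) (auto simp: mult_left_mono)
    then show "\<exists>y. ((\<lambda>s. exp (- (b * s)) * \<Theta> s) has_real_derivative y) (at s) \<and> y \<le> 0"
      using d2[of s] s t at_within_Icc_at[of 0 s T] by auto
  qed
  then have "exp (- (b * t)) * \<Theta> t \<le> C" by (simp add: \<Theta>_def)
  then have "\<Theta> t \<le> C * exp (b * t)" by (simp add: exp_minus field_simps)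
  then show ?thesis using le[OF t] by (simp add: \<Theta>_def)
qed

section \<open>Almost everywhere differentiability\<close>

lemma AE_lborel_translate:
  fixes c :: "'a::euclidean_space"
  assumes "AE x in lborel. P x"
  shows "AE x in lborel. P (c + x)"
proof -
  have "AE x in distr lborel borel ((+) c). P x"
    by (subst lborel_distr_plus) (rule assms)
  then show ?thesis by (rule AE_distrD[rotated]) simp
qed

lemma AE_lborel_imp_ex_in_open:
  assumes "AE z in lborel. z \<in> S \<longrightarrow> P z" "open S" "z\<^sub>0 \<in> S"
  obtains z where "z \<in> S" "P (z::'a::euclidean_space)"
proof -
  have "\<exists>z\<in>S. P z"
  proof (rule ccontr)
    assume no: "\<not> (\<exists>z\<in>S. P z)"
    have "AE z\<in>S in lborel. z \<in> {}"
      using assms(1) by eventually_elim (use no in blast)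
    then have "AE z\<in>S in lebesgue. z \<in> {}" by (rule AE_completion)
    from mem_closed_if_AE_lebesgue_open[OF assms(2) closed_empty this assms(3)] show False by simp
  qed
  then show thesis using that by blast
qed

text \<open>
  Fubini's theorem for the set of all \<open>(z, s)\<close> with \<open>z + s d \<in> N\<close>. Parametrising lines by all of their points, not by
  the points of a complement of \<open>d\<close>, makes every direction as good as a coordinate axis.
\<close>

lemma AE_lines_commute:
  fixes d :: "'a::euclidean_space"
  assumes N: "N \<in> sets borel"
  shows "(AE z in lborel. AE s in lborel. z + s *\<^sub>R d \<notin> N) \<longleftrightarrow>
         (AE s in lborel. AE z in lborel. z + s *\<^sub>R d \<notin> N)"
proof (rule lborel_pair.AE_commute)
  have "(\<lambda>w. fst w + snd w *\<^sub>R d) \<in> borel_measurable (lborel \<Otimes>\<^sub>M lborel)" by measurable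
  from measurable_sets[OF this, of "- N"] N
  show "{w \<in> space (lborel \<Otimes>\<^sub>M lborel). fst w + snd w *\<^sub>R d \<notin> N} \<in> sets (lborel \<Otimes>\<^sub>M lborel)"
    by (simp add: vimage_def Int_def conj_commute)
qed

text \<open>
  After exchanging the order, a single \<open>s\<close> with \<open>z + s d \<notin> N\<close> for almost all \<open>z\<close> suffices, since Lebesgue measure is
  translation invariant.
\<close>

lemma AE_not_in_if_null_on_lines:
  fixes d :: "'a::euclidean_space"
  assumes N: "N \<in> sets borel" and null: "\<And>z. AE s in lborel. z + s *\<^sub>R d \<notin> N"
  shows "AE z in lborel. z \<notin> N"
proof -
  have "AE s in lborel. AE z in lborel. z + s *\<^sub>R d \<notin> N"
    using AE_lines_commute[OF N, of d] null by simp
  then have "AE s in lborel. s \<in> UNIV \<longrightarrow> (AE z in lborel. z + s *\<^sub>R d \<notin> N)" by simp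
  then obtain s where "AE z in lborel. z + s *\<^sub>R d \<notin> N"
    by (rule AE_lborel_imp_ex_in_open) auto
  from AE_lborel_translate[OF this, of "- (s *\<^sub>R d)"] show ?thesis by simp
qed

lemma AE_on_almost_all_lines:
  fixes d :: "'a::euclidean_space"
  assumes "AE z in lborel. P z"
  shows "AE z in lborel. AE s in lborel. P (z + s *\<^sub>R d)"
proof -
  obtain N where N: "{z \<in> space lborel. \<not> P z} \<subseteq> N" "emeasure lborel N = 0" "N \<in> sets lborel"
    using assms by (rule AE_E)
  have "AE z in lborel. z \<notin> N" using N by (intro AE_not_in) auto
  then have "AE z in lborel. z + s *\<^sub>R d \<notin> N" for s
    using AE_lborel_translate[of "\<lambda>z. z \<notin> N" "s *\<^sub>R d"] by (simp add: add.commute)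
  then have "AE z in lborel. AE s in lborel. z + s *\<^sub>R d \<notin> N"
    using AE_lines_commute[of N d] N(3) by simp
  then show ?thesis
  proof eventually_elim
    case (elim z)
    then show ?case by eventually_elim (use N(1) in auto)
  qed
qed

text \<open>
  On each line parallel to \<open>b\<close> the exceptional points are kinks of a real function, so there are countably many of them. The
  exceptional set is Borel because directional derivatives are limits of difference quotients along \<open>1 / Suc k\<close>.
\<close>

lemma AE_two_sided_dir_derivs:
  fixes J :: "'a::euclidean_space \<Rightarrow> real"
  assumes G: "open G" and lip: "K-lipschitz_on G J"
    and ex: "\<And>z v. z \<in> G \<Longrightarrow> \<exists>l. has_dir_deriv J z v l"
  shows "AE z in lborel. z \<in> G \<longrightarrow> (\<forall>r l. has_dir_deriv J z b r \<longrightarrow> has_dir_deriv J z (- b) l \<longrightarrow> r = - l)"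
proof -
  define D where "D v z = (SOME l. has_dir_deriv J z v l)" for v z
  have D: "has_dir_deriv J z v (D v z)" if "z \<in> G" for z v
    unfolding D_def using ex[OF that] by (rule someI_ex)
  have meas: "(\<lambda>z. indicat_real G z *\<^sub>R D v z) \<in> borel_measurable borel" for v
  proof (rule borel_measurable_LIMSEQ_real)
    \<comment> \<open>The quotient at \<open>z\<close> is only controlled when its second point lies in \<open>G\<close> too.\<close>
    define A where "A k = {z \<in> G. z + (1 / real (Suc k)) *\<^sub>R v \<in> G}" for k
    have "open (A k)" for k
    proof -
      have "A k = G \<inter> (\<lambda>z. z + (1 / real (Suc k)) *\<^sub>R v) -` G" by (auto simp: A_def)
      moreover have "open ((\<lambda>z. z + (1 / real (Suc k)) *\<^sub>R v) -` G)"
        by (rule open_vimage[OF G]) (intro continuous_intros)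
      ultimately show ?thesis using G by auto
    qed
    then have A: "A k \<in> sets borel" for k by simp
    show "(\<lambda>z. indicat_real (A k) z *\<^sub>R ((J (z + (1 / real (Suc k)) *\<^sub>R v) - J z) / (1 / real (Suc k))))
        \<in> borel_measurable borel" for k
    proof (rule borel_measurable_continuous_on_indicator[OF A])
      have J: "continuous_on G J" using lip by (rule lipschitz_on_continuous_on)
      have "continuous_on (A k) (\<lambda>z. J (z + (1 / real (Suc k)) *\<^sub>R v))"
        by (rule continuous_on_compose2[OF J]) (auto simp: A_def intro!: continuous_intros)
      moreover have "continuous_on (A k) J" using J by (rule continuous_on_subset) (auto simp: A_def)
      ultimately show "continuous_on (A k) (\<lambda>z. (J (z + (1 / real (Suc k)) *\<^sub>R v) - J z) / (1 / real (Suc k)))"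
        by (intro continuous_intros) auto
    qed
    fix z :: 'a
    show "(\<lambda>k. indicat_real (A k) z *\<^sub>R ((J (z + (1 / real (Suc k)) *\<^sub>R v) - J z) / (1 / real (Suc k))))
        \<longlonglongrightarrow> indicat_real G z *\<^sub>R D v z"
    proof (cases "z \<in> G")
      case False
      then show ?thesis by (simp add: A_def)
    next
      case True
      have lim: "filterlim (\<lambda>k. 1 / real (Suc k)) (at_right 0) sequentially"
        unfolding filterlim_at using LIMSEQ_Suc[OF lim_1_over_n] by auto
      have q: "(\<lambda>k. (J (z + (1 / real (Suc k)) *\<^sub>R v) - J z) / (1 / real (Suc k))) \<longlonglongrightarrow> D v z"
        using filterlim_compose[OF D[OF True, of v, unfolded has_dir_deriv_def] lim] by simp
      have "(\<lambda>k. z + (1 / real (Suc k)) *\<^sub>R v) \<longlonglongrightarrow> z + 0 *\<^sub>R v"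
        using lim by (intro tendsto_intros) (simp add: filterlim_at)
      then have "\<forall>\<^sub>F k in sequentially. z + (1 / real (Suc k)) *\<^sub>R v \<in> G"
        using topological_tendstoD[OF _ G, of _ z] True by simp
      then have "\<forall>\<^sub>F k in sequentially. (J (z + (1 / real (Suc k)) *\<^sub>R v) - J z) / (1 / real (Suc k)) =
          indicat_real (A k) z *\<^sub>R ((J (z + (1 / real (Suc k)) *\<^sub>R v) - J z) / (1 / real (Suc k)))"
        by eventually_elim (use True in \<open>simp add: A_def\<close>)
      from Lim_transform_eventually[OF q this] True show ?thesis by simp
    qed
  qed
  define N where "N = {z. indicat_real G z *\<^sub>R D b z \<noteq> - (indicat_real G z *\<^sub>R D (- b) z)}"
  have N: "N \<in> sets borel"
    unfolding N_def using meas[of b] meas[of "- b"] by measurable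
  have "AE z in lborel. z \<notin> N"
  proof (rule AE_not_in_if_null_on_lines[OF N])
    fix z
    have "{s. z + s *\<^sub>R b \<in> N} \<subseteq>
       {s. \<exists>r l. has_dir_deriv (\<lambda>s. J (z + s *\<^sub>R b)) s 1 r \<and> has_dir_deriv (\<lambda>s. J (z + s *\<^sub>R b)) s (-1) l \<and> r \<noteq> - l}"
    proof
      fix s assume "s \<in> {s. z + s *\<^sub>R b \<in> N}"
      then have s: "z + s *\<^sub>R b \<in> G" "D b (z + s *\<^sub>R b) \<noteq> - D (- b) (z + s *\<^sub>R b)"
        by (cases "z + s *\<^sub>R b \<in> G"; auto simp: N_def)+
      have "((\<lambda>s. z + s *\<^sub>R b) has_vector_derivative b) (at s)"
        by (auto intro!: derivative_eq_intros)
      note curve = has_dir_deriv_along_curve[OF lip G _ this]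
      have "has_dir_deriv (\<lambda>s. J (z + s *\<^sub>R b)) s 1 (D b (z + s *\<^sub>R b))"
        using s D by (intro curve) auto
      moreover have "has_dir_deriv (\<lambda>s. J (z + s *\<^sub>R b)) s (-1) (D (- b) (z + s *\<^sub>R b))"
        using s D by (intro curve) auto
      ultimately show "s \<in> {s. \<exists>r l. has_dir_deriv (\<lambda>s. J (z + s *\<^sub>R b)) s 1 r \<and>
          has_dir_deriv (\<lambda>s. J (z + s *\<^sub>R b)) s (-1) l \<and> r \<noteq> - l}"
        using s(2) by blast
    qed
    then have "countable {s. z + s *\<^sub>R b \<in> N}"
      by (rule countable_subset) (rule countable_one_sided_derivs_differ)
    then have "{s. z + s *\<^sub>R b \<in> N} \<in> null_sets lborel"
      by (rule countable_imp_null_set_lborel)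
    from AE_not_in[OF this] show "AE s in lborel. z + s *\<^sub>R b \<notin> N" by simp
  qed
  then show ?thesis
  proof eventually_elim
    case (elim z)
    show ?case
    proof (intro impI allI)
      fix r l assume "z \<in> G" "has_dir_deriv J z b r" "has_dir_deriv J z (- b) l"
      moreover from this have "r = D b z" "l = D (- b) z"
        using D has_dir_deriv_unique by blast+
      ultimately show "r = - l" using elim by (simp add: N_def)
    qed
  qed
qed

text \<open>
  A gradient bound that holds almost everywhere bounds the increments of \<open>J\<close> along almost all segments parallel to
  \<open>d\<close>, by integration. Both ends of the segment depend continuously on its starting point, so the bound
  extends to the segment that starts at \<open>z\<^sub>0\<close>, even if that segment lies in the exceptional set.
\<close>

lemma increment_lower_bound_from_AE:
  fixes J :: "'a::euclidean_space \<Rightarrow> real"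
  assumes G: "open G" and lip: "K-lipschitz_on G J" and z0: "z\<^sub>0 \<in> G"
    and ae: "AE z in lborel. z \<in> G \<longrightarrow> (\<exists>D. (J has_derivative D) (at z) \<and> m \<le> D d)"
  shows "\<forall>\<^sub>F h in at_right 0. h * m \<le> J (z\<^sub>0 + h *\<^sub>R d) - J z\<^sub>0"
proof -
  obtain e where e: "e > 0" "ball z\<^sub>0 e \<subseteq> G" using G z0 openE by blast
  define w where "w = norm d + 1"
  have pos: "w > 0" by (simp add: w_def add_nonneg_pos)
  define h0 where "h0 = e / (2 * w)"
  have h0: "h0 > 0" using e pos by (simp add: h0_def)
  have small: "h * norm d < e / 2" if "0 \<le> h" "h < h0" for h
  proof -
    have "h * norm d \<le> h0 * norm d" using that by (intro mult_right_mono) auto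
    also have "\<dots> < h0 * w" using h0 by (simp add: w_def)
    also have "\<dots> = e / 2" using pos by (simp add: h0_def)
    finally show ?thesis .
  qed
  have K: "K \<ge> 0" using lip by (rule lipschitz_on_nonneg)
  have main: "h * m \<le> J (z\<^sub>0 + h *\<^sub>R d) - J z\<^sub>0" if h: "0 < h" "h < h0" for h
  proof -
    have inG: "z + s *\<^sub>R d \<in> G" if "z \<in> cball z\<^sub>0 (e/2)" "s \<in> {0..h}" for z s
    proof -
      have "dist z\<^sub>0 (z + s *\<^sub>R d) \<le> dist z\<^sub>0 z + s * norm d"
        using norm_triangle_ineq4[of "z\<^sub>0 - z" "s *\<^sub>R d"] that by (simp add: dist_norm algebra_simps)
      also have "\<dots> < e" using small[of s] that h by auto
      finally show ?thesis using e by auto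
    qed
    define C where "C = {z \<in> cball z\<^sub>0 (e/2). J z + h * m \<le> J (z + h *\<^sub>R d)}"
    have contJ: "continuous_on G J" using lip by (rule lipschitz_on_continuous_on)
    have "closed C" unfolding C_def
    proof (rule continuous_on_closed_Collect_le)
      have "cball z\<^sub>0 (e/2) \<subseteq> G" using inG[of _ 0] h by auto
      then show "continuous_on (cball z\<^sub>0 (e/2)) (\<lambda>z. J z + h * m)"
        by (intro continuous_intros continuous_on_subset[OF contJ])
      show "continuous_on (cball z\<^sub>0 (e/2)) (\<lambda>z. J (z + h *\<^sub>R d))"
        by (rule continuous_on_compose2[OF contJ]) (use inG[of _ h] h in \<open>auto intro!: continuous_intros\<close>)
    qed simp
    have "AE z in lborel. z \<in> ball z\<^sub>0 (e/2) \<longrightarrow> z \<in> C"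
      using AE_on_almost_all_lines[OF ae, of d]
    proof eventually_elim
      case (elim z)
      show ?case
      proof
        assume z: "z \<in> ball z\<^sub>0 (e/2)"
        define \<psi> where "\<psi> s = J (z + s *\<^sub>R d)" for s
        have "(K * norm d)-lipschitz_on {0..h} \<psi>"
        proof (rule lipschitz_onI)
          show "dist (\<psi> s) (\<psi> t) \<le> K * norm d * dist s t" if "s \<in> {0..h}" "t \<in> {0..h}" for s t
          proof -
            have "dist (\<psi> s) (\<psi> t) \<le> K * dist (z + s *\<^sub>R d) (z + t *\<^sub>R d)"
              unfolding \<psi>_def using z that by (intro lipschitz_onD[OF lip] inG) auto
            also have "dist (z + s *\<^sub>R d) (z + t *\<^sub>R d) = dist s t * norm d"
              by (simp add: dist_norm scaleR_diff_left[symmetric])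
            finally show ?thesis by (simp add: mult_ac)
          qed
        qed (use K in simp)
        then have ac: "absolutely_continuous_on {0..h} \<psi>"
          by (rule lipschitz_imp_absolutely_continuous_on)
        have "AE s in lebesgue. z + s *\<^sub>R d \<in> G \<longrightarrow> (\<exists>D. (J has_derivative D) (at (z + s *\<^sub>R d)) \<and> m \<le> D d)"
          using elim by (rule AE_completion)
        then have "AE s in lebesgue_on {0..h}. z + s *\<^sub>R d \<in> G \<longrightarrow> (\<exists>D. (J has_derivative D) (at (z + s *\<^sub>R d)) \<and> m \<le> D d)"
          by (subst AE_restrict_space_iff) auto
        moreover have "AE s in lebesgue_on {0..h}. s \<in> {0..h}" by (rule AE_I2) (simp add: space_restrict_space)
        ultimately have "AE s in lebesgue_on {0..h}. \<exists>D. (\<psi> has_real_derivative D) (at s within {0..h}) \<and> m \<le> D"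
        proof eventually_elim
          case (elim s)
          then have "z + s *\<^sub>R d \<in> G" using inG z by auto
          then obtain D where D: "(J has_derivative D) (at (z + s *\<^sub>R d))" "m \<le> D d" using elim by blast
          have "((\<lambda>s. z + s *\<^sub>R d) has_vector_derivative d) (at s within {0..h})"
            by (auto intro!: derivative_eq_intros)
          then have "(\<psi> has_vector_derivative D d) (at s within {0..h})"
            using vector_derivative_diff_chain_within[of "\<lambda>s. z + s *\<^sub>R d" d s "{0..h}" J D]
              has_derivative_at_withinI[OF D(1)] by (simp add: o_def \<psi>_def[abs_def])
          then show ?case using D by (auto simp: has_real_derivative_iff_has_vector_derivative)
        qed
        then have "h * m \<le> \<psi> h - \<psi> 0"
          using h has_integral_const_real[of m 0 h]
          by (intro absolutely_continuous_increment_ge[OF _ ac]) auto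
        then show "z \<in> C" using z by (simp add: C_def \<psi>_def)
      qed
    qed
    then have "AE z\<in>ball z\<^sub>0 (e/2) in lebesgue. z \<in> C" by (rule AE_completion)
    from mem_closed_if_AE_lebesgue_open[OF open_ball \<open>closed C\<close> this, of z\<^sub>0] e
    show ?thesis by (simp add: C_def)
  qed
  show ?thesis unfolding eventually_at_right_field using h0 main by (intro exI[of _ h0]) auto
qed

section \<open>Gradients at points of differentiability\<close>

lemma differentiable_imp_gradient:
  fixes J :: "'a::euclidean_space \<Rightarrow> real"
  assumes "J differentiable (at z)"
  obtains P where "(J has_derivative (\<lambda>h. P \<bullet> h)) (at z)"
proof -
  obtain D where D: "(J has_derivative D) (at z)" using assms unfolding differentiable_def by blast
  then have "linear D" by (rule has_derivative_linear)
  then have "D h = adjoint D 1 \<bullet> h" for h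
    using adjoint_works[of D h 1] by (simp add: inner_commute)
  then have "D = (\<lambda>h. adjoint D 1 \<bullet> h)" by blast
  then show thesis using that D by metis
qed

lemma has_derivative_imp_has_dir_deriv:
  fixes J :: "'a::euclidean_space \<Rightarrow> real"
  assumes "(J has_derivative (\<lambda>h. P \<bullet> h)) (at z)"
  shows "has_dir_deriv J z v (P \<bullet> v)"
proof -
  have "((\<lambda>h. z + h *\<^sub>R v) has_vector_derivative v) (at 0)"
    by (auto intro!: derivative_eq_intros)
  then have "((\<lambda>h. J (z + h *\<^sub>R v)) has_vector_derivative (P \<bullet> v)) (at 0)"
    using vector_derivative_diff_chain_within[of "\<lambda>h. z + h *\<^sub>R v" v 0 UNIV J "\<lambda>h. P \<bullet> h"]
      has_derivative_at_withinI[OF assms] by (simp add: o_def)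
  then have "((\<lambda>h. J (z + h *\<^sub>R v)) has_real_derivative (P \<bullet> v)) (at 0)"
    by (simp add: has_real_derivative_iff_has_vector_derivative)
  then have "((\<lambda>h. (J (z + h *\<^sub>R v) - J z) / h) \<longlongrightarrow> P \<bullet> v) (at 0)"
    unfolding DERIV_def by simp
  then show ?thesis unfolding has_dir_deriv_def by (rule tendsto_within_subset) auto
qed

text \<open>
  A bound of difference quotients near \<open>z\<close> bounds the directional derivatives at all points near \<open>z\<close>; this
  upper semicontinuity is what puts limits of gradients into the Clarke gradient.
\<close>

lemma has_dir_deriv_le_clarke_slope:
  assumes "m \<in> clarke_slopes J z v"
  shows "\<forall>\<^sub>F y in nhds z. \<forall>l. has_dir_deriv J y v l \<longrightarrow> l \<le> m"
proof -
  obtain d where d: "d > 0"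
    "\<forall>y h. dist y z < d \<longrightarrow> 0 < h \<longrightarrow> h < d \<longrightarrow> J (y + h *\<^sub>R v) - J y \<le> h * m"
    using assms unfolding clarke_slopes_def by blast
  have "l \<le> m" if "dist y z < d" "has_dir_deriv J y v l" for y l
  proof (rule tendsto_upperbound)
    show "((\<lambda>h. (J (y + h *\<^sub>R v) - J y) / h) \<longlongrightarrow> l) (at_right 0)"
      using that(2) by (simp add: has_dir_deriv_def)
    show "\<forall>\<^sub>F h in at_right 0. (J (y + h *\<^sub>R v) - J y) / h \<le> m"
      unfolding eventually_at_right_field
      using d that(1) by (intro exI[of _ d]) (auto simp: field_simps)
  qed simp
  then show ?thesis unfolding eventually_nhds_metric using d(1) by blast
qed

lemma limit_of_gradients_in_clarke_gradient:
  fixes J :: "'a::euclidean_space \<Rightarrow> real"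
  assumes deriv: "\<And>n. (J has_derivative (\<lambda>h. P n \<bullet> h)) (at (z n))"
    and z: "z \<longlonglongrightarrow> z\<^sub>0" and P: "P \<longlonglongrightarrow> P\<^sub>0"
  shows "P\<^sub>0 \<in> clarke_gradient J z\<^sub>0"
  unfolding clarke_gradient_iff_slopes
proof (intro allI ballI)
  fix v m assume "m \<in> clarke_slopes J z\<^sub>0 v"
  from eventually_compose_filterlim[OF has_dir_deriv_le_clarke_slope[OF this] z]
  have "\<forall>\<^sub>F n in sequentially. P n \<bullet> v \<le> m"
    by eventually_elim (use has_derivative_imp_has_dir_deriv[OF deriv] in blast)
  then show "P\<^sub>0 \<bullet> v \<le> m"
    by (intro tendsto_upperbound[OF tendsto_inner[OF P tendsto_const]]) auto
qed

text \<open>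
  A gradient is an element of the Clarke gradient, where \<open>K * norm v\<close> bounds the value at \<open>v\<close>; take \<open>v = P\<close>.
\<close>

lemma norm_gradient_le_lipschitz:
  fixes J :: "'a::euclidean_space \<Rightarrow> real"
  assumes lip: "K-lipschitz_on \<Omega> J" and z: "z \<in> interior \<Omega>"
    and deriv: "(J has_derivative (\<lambda>h. P \<bullet> h)) (at z)"
  shows "norm P \<le> K"
proof -
  have "P \<in> clarke_gradient J z"
    using limit_of_gradients_in_clarke_gradient[of J "\<lambda>_. P" "\<lambda>_. z"] deriv by simp
  then have "P \<bullet> P \<le> K * norm P"
    using clarke_slopes_nonempty[OF lip z] by (simp add: clarke_gradient_iff_slopes)
  then show ?thesis
    using lipschitz_on_nonneg[OF lip] by (cases "P = 0") (auto simp: dot_square_norm power2_eq_square)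
qed

section \<open>Trajectories of class L problems\<close>

text \<open>
  The Lipschitz constant in the state is uniform in time and input, so continuity at each fixed state is
  enough for joint continuity.
\<close>

lemma continuous_on_time_state_input:
  fixes F :: "real \<Rightarrow> 'a::real_normed_vector \<Rightarrow> 'b::metric_space \<Rightarrow> 'c::real_normed_vector"
  assumes uc: "\<And>x. uniformly_continuous_on (I \<times> U) (\<lambda>(t, u). F t x u)"
    and lip: "\<And>t u x y. t \<in> I \<Longrightarrow> u \<in> U \<Longrightarrow> norm (F t x u - F t y u) \<le> \<alpha> * norm (x - y)"
    and "\<alpha> > 0"
  shows "continuous_on (I \<times> UNIV \<times> U) (\<lambda>(t, x, u). F t x u)"
  unfolding continuous_on_iff
proof (intro ballI allI impI)
  fix w and e :: real assume w: "w \<in> I \<times> (UNIV :: 'a set) \<times> U" and "e > 0"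
  obtain t x u where txu: "w = (t, x, u)" "t \<in> I" "u \<in> U" using w by auto
  have "continuous_on (I \<times> U) (\<lambda>(t, u). F t x u)" using uc by (rule uniformly_continuous_imp_continuous)
  then have "\<exists>d>0. \<forall>w'\<in>I \<times> U. dist w' (t, u) < d \<longrightarrow>
      dist (case w' of (t, u) \<Rightarrow> F t x u) (case (t, u) of (t, u) \<Rightarrow> F t x u) < e / 2"
    using \<open>e > 0\<close> txu(2,3) unfolding continuous_on_iff by (meson SigmaI half_gt_zero)
  then obtain d where d: "d > 0" "\<forall>w'\<in>I \<times> U. dist w' (t, u) < d \<longrightarrow>
      dist (case w' of (t, u) \<Rightarrow> F t x u) (F t x u) < e / 2"
    by auto
  define d' where "d' = min (d / 2) (e / (2 * \<alpha>))"
  have d': "d' > 0" using d \<open>e > 0\<close> \<open>\<alpha> > 0\<close> by (simp add: d'_def)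
  have "dist (F t' x' u') (F t x u) < e" if t': "t' \<in> I" "u' \<in> U" "dist (t', x', u') (t, x, u) < d'" for t' x' u'
  proof -
    have le: "dist t' t < d'" "dist x' x < d'" "dist u' u < d'"
      using t'(3) dist_fst_le[of "(t', x', u')" "(t, x, u)"] dist_snd_le[of "(t', x', u')" "(t, x, u)"]
        dist_fst_le[of "(x', u')" "(x, u)"] dist_snd_le[of "(x', u')" "(x, u)"] by auto
    have "dist (t', u') (t, u) \<le> dist t' t + dist u' u"
      unfolding dist_prod_def by (simp add: sqrt_sum_squares_le_sum)
    then have "dist (t', u') (t, u) < d" using le by (simp add: d'_def)
    then have 1: "dist (F t' x u') (F t x u) < e / 2" using d(2)[rule_format, of "(t', u')"] t' by simp
    have "dist (F t' x' u') (F t' x u') \<le> \<alpha> * dist x' x"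
      using lip[OF t'(1,2)] by (simp add: dist_norm)
    also have "\<dots> < \<alpha> * (e / (2 * \<alpha>))"
      using le \<open>\<alpha> > 0\<close> by (intro mult_strict_left_mono) (auto simp: d'_def)
    also have "\<dots> = e / 2" using \<open>\<alpha> > 0\<close> by simp
    finally show ?thesis using 1 dist_triangle[of "F t' x' u'" "F t x u" "F t' x u'"] by linarith
  qed
  then show "\<exists>d>0. \<forall>w'\<in>I \<times> UNIV \<times> U. dist w' w < d \<longrightarrow>
      dist (case w' of (t, x, u) \<Rightarrow> F t x u) (case w of (t, x, u) \<Rightarrow> F t x u) < e"
    using d' txu(1) by (intro exI[of _ d']) auto
qed

locale class_L_problem =
  fixes c :: "real \<Rightarrow> real^'n \<Rightarrow> real^'m \<Rightarrow> real" and g :: "real^'n \<Rightarrow> real"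
    and f :: "real \<Rightarrow> real^'n \<Rightarrow> real^'m \<Rightarrow> real^'n" and U :: "(real^'m) set" and T \<beta> :: real
  assumes class_L: "class_L c g f U T \<beta>"
begin

lemma T_pos: "T > 0" and compact_U: "compact U" and beta_pos: "\<beta> > 0"
  and growth_f: "t \<in> {0..T} \<Longrightarrow> u \<in> U \<Longrightarrow> norm (f t x u) \<le> \<beta> * (1 + norm x)"
  using class_L unfolding class_L_def by blast+

lemma lipschitz_f:
  obtains \<alpha> where "\<alpha> > 0" "\<And>t u x y. t \<in> {0..T} \<Longrightarrow> u \<in> U \<Longrightarrow> norm (f t x u - f t y u) \<le> \<alpha> * norm (x - y)"
proof -
  obtain \<alpha> where "\<alpha> > 0" "\<forall>t\<in>{0..T}. \<forall>u\<in>U. \<forall>x y. norm (f t x u - f t y u) \<le> \<alpha> * norm (x - y)"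
    using class_L unfolding class_L_def by blast
  then show thesis by (intro that[of \<alpha>]) blast+
qed

lemma growth_c:
  obtains B where "B > 0" "\<And>t u x. t \<in> {0..T} \<Longrightarrow> u \<in> U \<Longrightarrow> \<bar>c t x u\<bar> \<le> B * (1 + norm x)"
proof -
  obtain B where "B > 0" "\<forall>t\<in>{0..T}. \<forall>u\<in>U. \<forall>x. \<bar>c t x u\<bar> \<le> B * (1 + norm x)"
    using class_L unfolding class_L_def by blast
  then show thesis by (intro that[of B]) blast+
qed

lemma continuous_f: "continuous_on ({0..T} \<times> UNIV \<times> U) (\<lambda>(t, x, u). f t x u)"
proof -
  obtain \<alpha> where "\<alpha> > 0" "\<And>t u x y. t \<in> {0..T} \<Longrightarrow> u \<in> U \<Longrightarrow> norm (f t x u - f t y u) \<le> \<alpha> * norm (x - y)"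
    using lipschitz_f by blast
  moreover have "uniformly_continuous_on ({0..T} \<times> U) (\<lambda>(t, u). f t x u)" for x
    using class_L unfolding class_L_def by blast
  ultimately show ?thesis by (intro continuous_on_time_state_input[of _ _ _ \<alpha>]) auto
qed

lemma continuous_c: "continuous_on ({0..T} \<times> UNIV \<times> U) (\<lambda>(t, x, u). c t x u)"
proof -
  obtain \<alpha> where "\<alpha> > 0" "\<forall>t\<in>{0..T}. \<forall>u\<in>U. \<forall>x y. \<bar>c t x u - c t y u\<bar> \<le> \<alpha> * norm (x - y)"
    using class_L unfolding class_L_def by blast
  moreover have "uniformly_continuous_on ({0..T} \<times> U) (\<lambda>(t, u). c t x u)" for x
    using class_L unfolding class_L_def by blast
  ultimately show ?thesis by (intro continuous_on_time_state_input[of _ _ _ \<alpha>]) auto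
qed

lemma continuous_on_g: "continuous_on S g"
proof -
  obtain \<alpha> where "\<alpha> > 0" "\<forall>x y. \<bar>g x - g y\<bar> \<le> \<alpha> * norm (x - y)"
    using class_L unfolding class_L_def by blast
  then have "\<alpha>-lipschitz_on S g" by (intro lipschitz_onI) (auto simp: dist_norm)
  then show ?thesis by (rule lipschitz_on_continuous_on)
qed

definition trajectory_of :: "(real \<Rightarrow> real^'m) \<Rightarrow> real^'n \<Rightarrow> (real \<Rightarrow> real^'n) \<Rightarrow> bool" where
  "trajectory_of v x\<^sub>0 y \<longleftrightarrow> admissible_input U 0 T v \<and> solves_ivp (\<lambda>t z. f t z (v t)) 0 T x\<^sub>0 y"

lemma trajectoryD:
  assumes "trajectory_of v x\<^sub>0 y"
  shows trajectory_input: "t \<in> {0..T} \<Longrightarrow> v t \<in> U"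
    and trajectory_input_measurable: "v \<in> borel_measurable (lebesgue_on {0..T})"
    and trajectory_start: "y 0 = x\<^sub>0"
    and trajectory_absolutely_continuous: "absolutely_continuous_on {0..T} y"
    and trajectory_continuous: "continuous_on {0..T} y"
  using assms absolutely_continuous_on_imp_continuous_on
  unfolding trajectory_of_def admissible_input_def solves_ivp_def by auto

lemma trajectory_derivative:
  assumes "trajectory_of v x\<^sub>0 y"
  obtains N where "negligible N"
    "\<forall>t\<in>{0..T} - N. (y has_vector_derivative f t (y t) (v t)) (at t within {0..T})"
proof -
  have "AE t in lebesgue_on {0..T}. (y has_vector_derivative f t (y t) (v t)) (at t within {0..T})"
    using assms unfolding trajectory_of_def solves_ivp_def by blast
  then obtain N where "negligible N"
    "\<forall>t\<in>{0..T} - N. (y has_vector_derivative f t (y t) (v t)) (at t within {0..T})"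
    using AE_lebesgue_on_iff_negligible[of "{0..T}"] by auto
  then show thesis by (rule that)
qed

lemma trajectory_has_integral:
  assumes y: "trajectory_of v x\<^sub>0 y" and t: "t \<in> {0..T}"
  shows "((\<lambda>s. f s (y s) (v s)) has_integral (y t - x\<^sub>0)) {0..t}"
proof -
  obtain N where N: "negligible N"
    "\<forall>t\<in>{0..T} - N. (y has_vector_derivative f t (y t) (v t)) (at t within {0..T})"
    by (rule trajectory_derivative[OF y])
  have sub: "{0..t} \<subseteq> {0..T}" using t by auto
  have "((\<lambda>s. f s (y s) (v s)) has_integral (y t - y 0)) {0..t}"
  proof (rule fundamental_theorem_of_calculus_absolutely_continuous)
    show "absolutely_continuous_on {0..t} y"
      using trajectory_absolutely_continuous[OF y] sub by (rule absolutely_continuous_on_subset)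
    show "(y has_vector_derivative f s (y s) (v s)) (at s within {0..t})" if "s \<in> {0..t} - N" for s
      using N(2)[rule_format, of s] that sub by (auto intro: has_vector_derivative_within_subset)
  qed (use t N in auto)
  then show ?thesis by (simp add: trajectory_start[OF y])
qed

text \<open>
  Linear growth of \<open>f\<close> makes \<open>1 + norm (y t)\<close> satisfy Gronwall's inequality with constant \<open>\<beta>\<close>.
\<close>

lemma trajectory_growth:
  assumes y: "trajectory_of v x\<^sub>0 y" and t: "t \<in> {0..T}"
  shows "1 + norm (y t) \<le> (1 + norm x\<^sub>0) * exp (\<beta> * t)"
proof (rule gronwall[OF _ _ _ t])
  have cont: "continuous_on {0..T} (\<lambda>s. 1 + norm (y s))"
    by (intro continuous_intros trajectory_continuous[OF y])
  then show "continuous_on {0..T} (\<lambda>s. 1 + norm (y s))" .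
  show "\<beta> \<ge> 0" using beta_pos by simp
  fix s assume s: "s \<in> {0..T}"
  have "norm (integral {0..s} (\<lambda>s. f s (y s) (v s))) \<le> integral {0..s} (\<lambda>s. \<beta> * (1 + norm (y s)))"
  proof (rule integral_norm_bound_integral)
    show "(\<lambda>s. f s (y s) (v s)) integrable_on {0..s}"
      using trajectory_has_integral[OF y s] by blast
    show "(\<lambda>s. \<beta> * (1 + norm (y s))) integrable_on {0..s}"
      using s by (intro integrable_continuous_interval continuous_intros
          continuous_on_subset[OF trajectory_continuous[OF y]]) auto
    show "norm (f r (y r) (v r)) \<le> \<beta> * (1 + norm (y r))" if "r \<in> {0..s}" for r
      using that s trajectory_input[OF y] by (intro growth_f) auto
  qed
  then have "norm (y s - x\<^sub>0) \<le> \<beta> * integral {0..s} (\<lambda>s. 1 + norm (y s))"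
    using trajectory_has_integral[OF y s] by (simp add: integral_unique)
  then show "1 + norm (y s) \<le> 1 + norm x\<^sub>0 + \<beta> * integral {0..s} (\<lambda>s. 1 + norm (y s))"
    using norm_triangle_sub[of "y s" x\<^sub>0] by linarith
qed

lemma trajectory_unique:
  assumes y: "trajectory_of v x\<^sub>0 y" and y': "trajectory_of v x\<^sub>0 y'" and t: "t \<in> {0..T}"
  shows "y t = y' t"
proof -
  obtain \<alpha> where \<alpha>: "\<alpha> > 0" "\<And>t u x y. t \<in> {0..T} \<Longrightarrow> u \<in> U \<Longrightarrow> norm (f t x u - f t y u) \<le> \<alpha> * norm (x - y)"
    using lipschitz_f by blast
  have cont: "continuous_on {0..T} (\<lambda>s. norm (y s - y' s))"
    by (intro continuous_intros trajectory_continuous[OF y] trajectory_continuous[OF y'])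
  have "norm (y t - y' t) \<le> 0 * exp (\<alpha> * t)"
  proof (rule gronwall[OF cont _ _ t])
    fix s assume s: "s \<in> {0..T}"
    have int: "((\<lambda>s. f s (y s) (v s) - f s (y' s) (v s)) has_integral (y s - y' s)) {0..s}"
      using has_integral_diff[OF trajectory_has_integral[OF y s] trajectory_has_integral[OF y' s]] by simp
    have "norm (integral {0..s} (\<lambda>s. f s (y s) (v s) - f s (y' s) (v s)))
        \<le> integral {0..s} (\<lambda>s. \<alpha> * norm (y s - y' s))"
    proof (rule integral_norm_bound_integral)
      show "(\<lambda>s. f s (y s) (v s) - f s (y' s) (v s)) integrable_on {0..s}" using int by blast
      show "(\<lambda>s. \<alpha> * norm (y s - y' s)) integrable_on {0..s}"
        using s by (intro integrable_continuous_interval continuous_on_mult_left continuous_on_subset[OF cont]) auto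
      show "norm (f r (y r) (v r) - f r (y' r) (v r)) \<le> \<alpha> * norm (y r - y' r)" if "r \<in> {0..s}" for r
        using that s trajectory_input[OF y] by (intro \<alpha>) auto
    qed
    then show "norm (y s - y' s) \<le> 0 + \<alpha> * integral {0..s} (\<lambda>s. norm (y s - y' s))"
      using int by (simp add: integral_unique)
  qed (use \<alpha> in simp)
  then show ?thesis by simp
qed

text \<open>
  Without integrability the Lebesgue integral in the cost would be the default value zero.
\<close>

lemma integrable_running_cost:
  assumes y: "trajectory_of v x\<^sub>0 y"
  shows "integrable (lebesgue_on {0..T}) (\<lambda>t. c t (y t) (v t))"
proof -
  let ?S = "{0..T} \<times> UNIV \<times> U :: (real \<times> (real^'n) \<times> (real^'m)) set"
  obtain B where B: "B > 0" "\<And>t u x. t \<in> {0..T} \<Longrightarrow> u \<in> U \<Longrightarrow> \<bar>c t x u\<bar> \<le> B * (1 + norm x)"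
    using growth_c by blast
  have "(\<lambda>t. t) \<in> borel_measurable (lebesgue_on {0..T})"
    by (rule continuous_imp_measurable_on_sets_lebesgue) auto
  moreover have "y \<in> borel_measurable (lebesgue_on {0..T})"
    using trajectory_continuous[OF y] by (rule continuous_imp_measurable_on_sets_lebesgue) auto
  ultimately have "(\<lambda>t. (t, y t, v t)) \<in> borel_measurable (lebesgue_on {0..T})"
    using trajectory_input_measurable[OF y] by (intro borel_measurable_Pair)
  then have "(\<lambda>t. (t, y t, v t)) \<in> lebesgue_on {0..T} \<rightarrow>\<^sub>M restrict_space borel ?S"
    using trajectory_input[OF y] by (intro measurable_restrict_space2) (auto simp: space_restrict_space)
  from measurable_compose[OF this borel_measurable_continuous_on_restrict[OF continuous_c]]
  have meas: "(\<lambda>t. c t (y t) (v t)) \<in> borel_measurable (lebesgue_on {0..T})" by simp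
  show ?thesis
  proof (rule measurable_bounded_by_integrable_imp_lebesgue_integrable[OF meas])
    show "integrable (lebesgue_on {0..T}) (\<lambda>t. B * (1 + norm (y t)))"
      by (intro continuous_imp_integrable_real continuous_intros trajectory_continuous[OF y])
    show "norm (c t (y t) (v t)) \<le> B * (1 + norm (y t))" if "t \<in> {0..T}" for t
      using B(2)[of t "v t" "y t"] trajectory_input[OF y] that by simp
  qed auto
qed

end

section \<open>Candidate value functions along trajectories\<close>

lemma hjb_residual_eq:
  fixes c :: "real \<Rightarrow> real^'n \<Rightarrow> real^'m \<Rightarrow> real"
  assumes deriv: "(J has_derivative (\<lambda>h. P \<bullet> h)) (at (t, x))"
  shows "hjb_residual c f U J t x = fst P + (INF u\<in>U. hamiltonian c f t x u (snd P))"
proof -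
  have "((\<lambda>s. (s, x)) has_derivative (\<lambda>a. (a, 0))) (at t)"
    by (auto intro!: derivative_eq_intros)
  from has_derivative_compose[OF this deriv]
  have "((\<lambda>s. J (s, x)) has_real_derivative fst P) (at t)"
    by (simp add: has_field_derivative_def inner_prod_def mult.commute[of _ "fst P"])
  then have 1: "deriv (\<lambda>s. J (s, x)) t = fst P" by (rule DERIV_imp_deriv)
  have "((\<lambda>y. (t, y)) has_derivative (\<lambda>a. (0, a))) (at x)"
    by (auto intro!: derivative_eq_intros)
  from has_derivative_compose[OF this deriv]
  have g: "GDERIV (\<lambda>y. J (t, y)) x :> snd P"
    by (simp add: gderiv_def inner_prod_def inner_commute)
  have "gradient (\<lambda>y. J (t, y)) x = snd P"
    unfolding gradient_def
  proof (rule the_equality)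
    show "GDERIV (\<lambda>y. J (t, y)) x :> snd P" by (rule g)
    fix D assume "GDERIV (\<lambda>y. J (t, y)) x :> D"
    then have "(\<lambda>h. h \<bullet> D) = (\<lambda>h. h \<bullet> snd P)"
      using g unfolding gderiv_def by (rule has_derivative_unique)
    then show "D = snd P" by (metis vector_eq_ldot)
  qed
  with 1 show ?thesis by (simp add: hjb_residual_def)
qed

text \<open>
  The hypotheses on a candidate \<open>J\<close> that both one-sided estimates share; \<open>D\<^sub>1\<close> is a finite essential bound of
  the residual.
\<close>

locale hjb_candidate = class_L_problem c g f U T \<beta>
  for c :: "real \<Rightarrow> real^'n \<Rightarrow> real^'m \<Rightarrow> real" and g f U T \<beta> +
  fixes J :: "real \<times> (real^'n) \<Rightarrow> real" and K D\<^sub>1 R :: real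
  assumes lipschitz_J: "K-lipschitz_on ({0..T} \<times> UNIV) J"
    and regular: "t \<in> {0<..<T} \<Longrightarrow> bidifferential ({0..T} \<times> UNIV) J (t, x) = clarke_gradient J (t, x)"
    and residual: "AE z in lborel. z \<in> {0<..<T} \<times> ball 0 R \<longrightarrow> \<bar>hjb_residual c f U J (fst z) (snd z)\<bar> \<le> D\<^sub>1"
begin

abbreviation "\<Omega> \<equiv> {0..T} \<times> (UNIV :: (real^'n) set)"
abbreviation "G \<equiv> {0<..<T} \<times> (ball 0 R :: (real^'n) set)"

lemma open_strip: "open ({0<..<T} \<times> (UNIV :: (real^'n) set))" and open_G: "open G"
  by (auto intro: open_Times)

lemma interior_strip: "t \<in> {0<..<T} \<Longrightarrow> (t, x) \<in> interior \<Omega>"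
  by (rule interiorI[OF open_strip]) auto

lemma K_nonneg: "K \<ge> 0"
  using lipschitz_J by (rule lipschitz_on_nonneg)

lemma lipschitz_strip: "K-lipschitz_on ({0<..<T} \<times> UNIV) J"
  using lipschitz_J by (rule lipschitz_on_subset) auto

lemma lipschitz_G: "K-lipschitz_on G J"
  using lipschitz_J by (rule lipschitz_on_subset) auto

lemma has_dir_deriv_ex: "t \<in> {0<..<T} \<Longrightarrow> \<exists>l. has_dir_deriv J (t, x) v l"
  using clarke_regular_has_dir_deriv[OF lipschitz_J interior_strip regular] by metis

lemma AE_differentiable: "AE z in lborel. z \<in> G \<longrightarrow> J differentiable (at z)"
proof -
  have "AE z in lborel. z \<in> {0<..<T} \<times> UNIV \<longrightarrow>
      (\<forall>r l. has_dir_deriv J z b r \<longrightarrow> has_dir_deriv J z (- b) l \<longrightarrow> r = - l)" for b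
    by (rule AE_two_sided_dir_derivs[OF open_strip lipschitz_strip]) (use has_dir_deriv_ex in auto)
  then have "AE z in lborel. \<forall>b\<in>Basis. z \<in> {0<..<T} \<times> UNIV \<longrightarrow>
      (\<forall>r l. has_dir_deriv J z b r \<longrightarrow> has_dir_deriv J z (- b) l \<longrightarrow> r = - l)"
    by (intro AE_finite_allI finite_Basis) auto
  then show ?thesis
  proof eventually_elim
    case (elim z)
    show ?case
    proof
      assume z: "z \<in> G"
      obtain t x where tx: "z = (t, x)" "t \<in> {0<..<T}" using z by auto
      show "J differentiable (at z)"
        unfolding tx(1)
        by (rule clarke_regular_differentiable[OF lipschitz_J interior_strip[OF tx(2)] regular[OF tx(2)]])
          (use elim tx in auto)
    qed
  qed
qed

text \<open>
  Almost everywhere the partial derivatives in the residual are the components of a true gradient \<open>P\<close>.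
\<close>

lemma AE_hjb: "AE z in lborel. z \<in> G \<longrightarrow> (\<exists>P. (J has_derivative (\<lambda>h. P \<bullet> h)) (at z) \<and> norm P \<le> K \<and>
    \<bar>fst P + (INF u\<in>U. hamiltonian c f (fst z) (snd z) u (snd P))\<bar> \<le> D\<^sub>1)"
  using AE_differentiable residual
proof eventually_elim
  case (elim z)
  show ?case
  proof
    assume z: "z \<in> G"
    with elim obtain P where P: "(J has_derivative (\<lambda>h. P \<bullet> h)) (at z)"
      using differentiable_imp_gradient by blast
    moreover have "norm P \<le> K"
      using norm_gradient_le_lipschitz[OF lipschitz_J _ P] interior_strip z by (cases z) auto
    moreover have "hjb_residual c f U J (fst z) (snd z) =
        fst P + (INF u\<in>U. hamiltonian c f (fst z) (snd z) u (snd P))"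
      using P by (intro hjb_residual_eq) simp
    ultimately show "\<exists>P. (J has_derivative (\<lambda>h. P \<bullet> h)) (at z) \<and> norm P \<le> K \<and>
      \<bar>fst P + (INF u\<in>U. hamiltonian c f (fst z) (snd z) u (snd P))\<bar> \<le> D\<^sub>1"
      using elim(2) z by (intro exI[of _ P]) simp
  qed
qed

text \<open>
  Makes the infimum over \<open>U\<close> in the residual a lower bound of the Hamiltonian at each input.
\<close>

lemma bdd_below_hamiltonian:
  assumes t: "t \<in> {0..T}"
  shows "bdd_below ((\<lambda>u. hamiltonian c f t x u q) ` U)"
proof -
  obtain B where B: "B > 0" "\<And>t u x. t \<in> {0..T} \<Longrightarrow> u \<in> U \<Longrightarrow> \<bar>c t x u\<bar> \<le> B * (1 + norm x)"
    by (rule growth_c) (rule that, blast+)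
  have "- (B * (1 + norm x)) - norm q * (\<beta> * (1 + norm x)) \<le> hamiltonian c f t x u q" if u: "u \<in> U" for u
  proof -
    have "\<bar>q \<bullet> f t x u\<bar> \<le> norm q * norm (f t x u)" by (rule Cauchy_Schwarz_ineq2)
    also have "\<dots> \<le> norm q * (\<beta> * (1 + norm x))"
      using growth_f[OF t u] by (intro mult_left_mono) auto
    finally show ?thesis using B(2)[OF t u, of x] unfolding hamiltonian_def by linarith
  qed
  then show ?thesis by (intro bdd_belowI2)
qed

text \<open>
  Near \<open>(t, x)\<close> the residual bounds the derivative of \<open>J\<close> in the direction \<open>(1, f t' x' u)\<close> of the moving point \<open>(t', x')\<close>.
  Replacing this direction and the cost by their values at \<open>(t, x)\<close> changes the bound by at most \<open>\<Phi> (t', x')\<close>, because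
  gradients have norm at most \<open>K\<close>, and \<open>\<Phi>\<close> is small near \<open>(t, x)\<close>.
\<close>

lemma dir_deriv_lower_bound:
  assumes z: "(t, x) \<in> G" and u: "u \<in> U" and r: "has_dir_deriv J (t, x) (1, f t x u) r"
  shows "- D\<^sub>1 - c t x u \<le> r"
proof (rule field_le_epsilon)
  fix e :: real assume e: "e > 0"
  define \<Phi> where "\<Phi> z = K * norm (f (fst z) (snd z) u - f t x u) + \<bar>c (fst z) (snd z) u - c t x u\<bar>" for z
  have emb: "continuous_on G (\<lambda>z. (fst z, snd z, u))" by (intro continuous_intros)
  have "(\<lambda>z. (fst z, snd z, u)) ` G \<subseteq> {0..T} \<times> UNIV \<times> U" using u by auto
  then have "continuous_on G (\<lambda>z. f (fst z) (snd z) u)" "continuous_on G (\<lambda>z. c (fst z) (snd z) u)"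
    using continuous_on_compose2[OF continuous_f emb] continuous_on_compose2[OF continuous_c emb] by simp_all
  then have "continuous_on G \<Phi>" unfolding \<Phi>_def by (intro continuous_intros)
  then have "\<forall>B. open B \<longrightarrow> open (\<Phi> -` B \<inter> G)"
    by (simp only: continuous_on_open_vimage[OF open_G])
  then have "open (\<Phi> -` {..<e} \<inter> G)" by simp
  define G' where "G' = \<Phi> -` {..<e} \<inter> G"
  have G': "open G'" "(t, x) \<in> G'" "G' \<subseteq> G"
    using \<open>open (\<Phi> -` {..<e} \<inter> G)\<close> z e by (auto simp: G'_def \<Phi>_def)
  have "AE w in lborel. w \<in> G' \<longrightarrow> (\<exists>D. (J has_derivative D) (at w) \<and> - D\<^sub>1 - c t x u - e \<le> D (1, f t x u))"
    using AE_hjb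
  proof eventually_elim
    case (elim w)
    show ?case
    proof
      assume w: "w \<in> G'"
      then have wG: "w \<in> G" and \<Phi>w: "\<Phi> w < e" using G' by (auto simp: G'_def)
      obtain P where P: "(J has_derivative (\<lambda>h. P \<bullet> h)) (at w)" "norm P \<le> K"
        "\<bar>fst P + (INF u\<in>U. hamiltonian c f (fst w) (snd w) u (snd P))\<bar> \<le> D\<^sub>1"
        using elim wG by blast
      have "fst w \<in> {0..T}" using wG by auto
      from cINF_lower[OF bdd_below_hamiltonian[OF this, of "snd w" "snd P"] u]
      have "- D\<^sub>1 \<le> fst P + hamiltonian c f (fst w) (snd w) u (snd P)"
        using P(3) by linarith
      then have 1: "- D\<^sub>1 \<le> fst P + (c (fst w) (snd w) u + snd P \<bullet> f (fst w) (snd w) u)"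
        by (simp add: hamiltonian_def)
      have "norm (snd P) \<le> K" using norm_snd_le[of "snd P" "fst P"] P(2) by simp
      then have "\<bar>snd P \<bullet> (f (fst w) (snd w) u - f t x u)\<bar> \<le> K * norm (f (fst w) (snd w) u - f t x u)"
        using Cauchy_Schwarz_ineq2[of "snd P"] by (meson mult_right_mono norm_ge_zero order_trans)
      then have "- D\<^sub>1 - c t x u - e \<le> fst P + snd P \<bullet> f t x u"
        using 1 \<Phi>w unfolding \<Phi>_def inner_diff_right by linarith
      then have "- D\<^sub>1 - c t x u - e \<le> P \<bullet> (1, f t x u)" by (simp add: inner_prod_def)
      then show "\<exists>D. (J has_derivative D) (at w) \<and> - D\<^sub>1 - c t x u - e \<le> D (1, f t x u)"
        using P(1) by blast
    qed
  qed
  from increment_lower_bound_from_AE[OF G'(1) lipschitz_on_subset[OF lipschitz_G G'(3)] G'(2) this]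
  have ev: "\<forall>\<^sub>F h in at_right 0. h * (- D\<^sub>1 - c t x u - e) \<le> J ((t, x) + h *\<^sub>R (1, f t x u)) - J (t, x)" .
  have "\<forall>\<^sub>F h in at_right 0. - D\<^sub>1 - c t x u - e \<le> (J ((t, x) + h *\<^sub>R (1, f t x u)) - J (t, x)) / h"
    using ev eventually_at_right_less[of 0] by eventually_elim (simp add: pos_le_divide_eq mult.commute)
  then have "- D\<^sub>1 - c t x u - e \<le> r"
    using r unfolding has_dir_deriv_def by (intro tendsto_lowerbound) auto
  then show "- D\<^sub>1 - c t x u \<le> r + e" by linarith
qed

text \<open>
  Gradients and nearly optimal inputs at points of differentiability tending to \<open>(t, x)\<close> lie in a compact set; a
  limit of them is a pair as wanted.
\<close>

lemma clarke_gradient_hamiltonian_le: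
  assumes z: "(t, x) \<in> G" and "U \<noteq> {}"
  obtains P u where "P \<in> clarke_gradient J (t, x)" "u \<in> U" "fst P + hamiltonian c f t x u (snd P) \<le> D\<^sub>1"
proof -
  have "\<exists>z P u. z \<in> G \<and> dist z (t, x) < 1 / real (Suc n) \<and> (J has_derivative (\<lambda>h. P \<bullet> h)) (at z) \<and>
     norm P \<le> K \<and> u \<in> U \<and> fst P + hamiltonian c f (fst z) (snd z) u (snd P) \<le> D\<^sub>1 + 1 / real (Suc n)" for n
  proof -
    define S where "S = G \<inter> ball (t, x) (1 / real (Suc n))"
    have S: "open S" "(t, x) \<in> S" using z by (auto simp: S_def intro!: open_Int open_G)
    have "AE z in lborel. z \<in> S \<longrightarrow> (\<exists>P. (J has_derivative (\<lambda>h. P \<bullet> h)) (at z) \<and> norm P \<le> K \<and>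
      \<bar>fst P + (INF u\<in>U. hamiltonian c f (fst z) (snd z) u (snd P))\<bar> \<le> D\<^sub>1)"
      using AE_hjb
    proof eventually_elim
      case (elim z)
      then show ?case unfolding S_def by blast
    qed
    from AE_lborel_imp_ex_in_open[OF this S]
    obtain w where w: "w \<in> S" and "\<exists>P. (J has_derivative (\<lambda>h. P \<bullet> h)) (at w) \<and> norm P \<le> K \<and>
      \<bar>fst P + (INF u\<in>U. hamiltonian c f (fst w) (snd w) u (snd P))\<bar> \<le> D\<^sub>1" by blast
    then obtain P where P: "(J has_derivative (\<lambda>h. P \<bullet> h)) (at w)" "norm P \<le> K"
      "\<bar>fst P + (INF u\<in>U. hamiltonian c f (fst w) (snd w) u (snd P))\<bar> \<le> D\<^sub>1" by blast
    have "(INF u\<in>U. hamiltonian c f (fst w) (snd w) u (snd P)) < D\<^sub>1 - fst P + 1 / real (Suc n)"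
    proof -
      have "0 < 1 / real (Suc n)" by simp
      then show ?thesis using P(3) by linarith
    qed
    then obtain u where u: "u \<in> U" "hamiltonian c f (fst w) (snd w) u (snd P) < D\<^sub>1 - fst P + 1 / real (Suc n)"
      using cInf_lessD[of "(\<lambda>u. hamiltonian c f (fst w) (snd w) u (snd P)) ` U"] \<open>U \<noteq> {}\<close> by auto
    then show ?thesis using w P by (intro exI[of _ w] exI[of _ P] exI[of _ u]) (auto simp: S_def dist_commute)
  qed
  then obtain z P u where zG: "\<And>n. z n \<in> G" and zd: "\<And>n. dist (z n) (t, x) < 1 / real (Suc n)"
    and P: "\<And>n. (J has_derivative (\<lambda>h. P n \<bullet> h)) (at (z n))" "\<And>n. norm (P n) \<le> K" and u: "\<And>n. u n \<in> U"
    and le: "\<And>n. fst (P n) + hamiltonian c f (fst (z n)) (snd (z n)) (u n) (snd (P n)) \<le> D\<^sub>1 + 1 / real (Suc n)"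
    by metis
  have cpt: "compact (cball (0 :: real \<times> (real^'n)) K \<times> U)"
    by (intro compact_Times compact_cball compact_U)
  have "(P n, u n) \<in> cball 0 K \<times> U" for n using P(2) u by auto
  from compact_def[THEN iffD1, OF cpt, rule_format, of "\<lambda>n. (P n, u n)", OF this]
  obtain l \<sigma> where l: "l \<in> cball 0 K \<times> U" and \<sigma>: "strict_mono \<sigma>"
    and lim: "((\<lambda>n. (P n, u n)) \<circ> \<sigma>) \<longlonglongrightarrow> l"
    by blast
  have Plim: "(\<lambda>n. P (\<sigma> n)) \<longlonglongrightarrow> fst l" using tendsto_fst[OF lim] by (simp add: o_def)
  have ulim: "(\<lambda>n. u (\<sigma> n)) \<longlonglongrightarrow> snd l" using tendsto_snd[OF lim] by (simp add: o_def)
  have inv: "(\<lambda>n. 1 / real (Suc n)) \<longlonglongrightarrow> 0" using LIMSEQ_Suc[OF lim_1_over_n] by simp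
  have "(\<lambda>n. dist (z n) (t, x)) \<longlonglongrightarrow> 0"
    using less_imp_le[OF zd]
    by (intro tendsto_sandwich[OF always_eventually always_eventually tendsto_const inv]) (simp_all only: zero_le_dist simp_thms)
  then have "z \<longlonglongrightarrow> (t, x)" by (rule tendsto_dist_iff[THEN iffD2])
  then have zlim: "(\<lambda>n. z (\<sigma> n)) \<longlonglongrightarrow> (t, x)"
    using LIMSEQ_subseq_LIMSEQ[OF _ \<sigma>] by (simp add: o_def)
  have tr: "(\<lambda>n. (fst (z (\<sigma> n)), snd (z (\<sigma> n)), u (\<sigma> n))) \<longlonglongrightarrow> (t, x, snd l)"
    using tendsto_fst[OF zlim] tendsto_snd[OF zlim] ulim by (auto intro!: tendsto_intros)
  have lU: "snd l \<in> U" using l by (cases l) auto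
  have inS: "(t, x, snd l) \<in> {0..T} \<times> UNIV \<times> U" using z lU by auto
  have ev: "\<forall>\<^sub>F n in sequentially. (fst (z (\<sigma> n)), snd (z (\<sigma> n)), u (\<sigma> n)) \<in> {0..T} \<times> UNIV \<times> U"
  proof (rule always_eventually, rule allI)
    show "(fst (z (\<sigma> n)), snd (z (\<sigma> n)), u (\<sigma> n)) \<in> {0..T} \<times> UNIV \<times> U" for n
      using zG[of "\<sigma> n"] u by (cases "z (\<sigma> n)") auto
  qed
  have "(\<lambda>n. f (fst (z (\<sigma> n))) (snd (z (\<sigma> n))) (u (\<sigma> n))) \<longlonglongrightarrow> f t x (snd l)"
    using continuous_on_tendsto_compose[OF continuous_f tr inS ev] by simp
  moreover have "(\<lambda>n. c (fst (z (\<sigma> n))) (snd (z (\<sigma> n))) (u (\<sigma> n))) \<longlonglongrightarrow> c t x (snd l)"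
    using continuous_on_tendsto_compose[OF continuous_c tr inS ev] by simp
  ultimately have "(\<lambda>n. fst (P (\<sigma> n)) + hamiltonian c f (fst (z (\<sigma> n))) (snd (z (\<sigma> n))) (u (\<sigma> n)) (snd (P (\<sigma> n))))
      \<longlonglongrightarrow> fst (fst l) + hamiltonian c f t x (snd l) (snd (fst l))"
    unfolding hamiltonian_def using Plim by (intro tendsto_intros)
  moreover have "(\<lambda>n. D\<^sub>1 + 1 / real (Suc (\<sigma> n))) \<longlonglongrightarrow> D\<^sub>1 + 0"
    using LIMSEQ_subseq_LIMSEQ[OF inv \<sigma>] by (intro tendsto_intros) (simp add: o_def)
  ultimately have "fst (fst l) + hamiltonian c f t x (snd l) (snd (fst l)) \<le> D\<^sub>1 + 0"
    by (rule LIMSEQ_le) (use le in blast)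
  moreover have "fst l \<in> clarke_gradient J (t, x)"
    by (rule limit_of_gradients_in_clarke_gradient[OF _ zlim Plim]) (rule P(1))
  ultimately show thesis using that[of "fst l" "snd l"] lU by simp
qed

text \<open>
  A supergradient bounds the forward difference quotients from above. A subgradient only bounds them from below,
  but it bounds the backward ones from above; this is why both one-sided derivatives and their equality are
  assumed.
\<close>

lemma dir_deriv_upper_bound:
  assumes z: "(t, x) \<in> G" and u: "u \<in> U"
    and min: "is_arg_min (\<lambda>(p, q, u). p + hamiltonian c f t x u q)
      (\<lambda>(p, q, u). (p, q) \<in> bidifferential \<Omega> J (t, x) \<and> u \<in> U) (p, q, u)"
    and r: "has_dir_deriv J (t, x) (1, f t x u) r" and l: "has_dir_deriv J (t, x) (- (1, f t x u)) (- r)"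
  shows "r \<le> D\<^sub>1 - c t x u"
proof -
  have t: "t \<in> {0<..<T}" using z by auto
  obtain P w where P: "P \<in> clarke_gradient J (t, x)" "w \<in> U" "fst P + hamiltonian c f t x w (snd P) \<le> D\<^sub>1"
    using clarke_gradient_hamiltonian_le[OF z] u by blast
  then have "p + hamiltonian c f t x u q \<le> fst P + hamiltonian c f t x w (snd P)"
    using min regular[OF t, of x] unfolding is_arg_min_def
    by (auto simp: not_less dest!: spec[of _ "fst P"] spec[of _ "snd P"] spec[of _ w])
  then have le: "p + q \<bullet> f t x u \<le> D\<^sub>1 - c t x u" using P(3) unfolding hamiltonian_def[of c f t x u q] by linarith
  have eq: "(p, q) \<bullet> (1, f t x u) = p + q \<bullet> f t x u" by (simp add: inner_prod_def)
  have pq: "(p, q) \<in> superdifferential \<Omega> J (t, x) \<union> subdifferential \<Omega> J (t, x)"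
    using min unfolding is_arg_min_def bidifferential_def by simp
  have pos: "\<forall>\<^sub>F h in at_right (0::real). h > 0" by (rule eventually_at_right_less)
  have "r \<le> p + q \<bullet> f t x u"
  proof (rule field_le_epsilon)
    fix e :: real assume e: "e > 0"
    from pq show "r \<le> p + q \<bullet> f t x u + e"
    proof
      assume "(p, q) \<in> superdifferential \<Omega> J (t, x)"
      from superdifferential_along_ray[OF lipschitz_J interior_strip[OF t] this e, of "(1, f t x u)"] pos
      have "\<forall>\<^sub>F h in at_right 0. (J ((t, x) + h *\<^sub>R (1, f t x u)) - J (t, x)) / h \<le> p + q \<bullet> f t x u + e"
        unfolding eq by eventually_elim (simp add: pos_divide_le_eq mult.commute)
      then show ?thesis
        using r unfolding has_dir_deriv_def by (intro tendsto_upperbound) auto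
    next
      assume "(p, q) \<in> subdifferential \<Omega> J (t, x)"
      from subdifferential_along_ray[OF lipschitz_J interior_strip[OF t] this e, of "- (1, f t x u)"] pos
      have "\<forall>\<^sub>F h in at_right 0. - (p + q \<bullet> f t x u) - e \<le> (J ((t, x) + h *\<^sub>R (- (1, f t x u))) - J (t, x)) / h"
        unfolding inner_minus_right eq by eventually_elim (simp only: pos_le_divide_eq mult.commute)
      then have "- (p + q \<bullet> f t x u) - e \<le> - r"
        using l unfolding has_dir_deriv_def by (intro tendsto_lowerbound) auto
      then show ?thesis by linarith
    qed
  qed
  then show ?thesis using le by linarith
qed

text \<open>
  The exceptional times are those where \<open>y\<close> fails to solve the differential equation, the countably many kinks
  of \<open>t \<mapsto> J (t, y t)\<close>, and the two end points.
\<close>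

lemma candidate_along_trajectory:
  assumes y: "trajectory_of v x\<^sub>0 y" and ball: "\<forall>t\<in>{0..<T}. y t \<in> ball 0 R"
  shows "absolutely_continuous_on {0..T} (\<lambda>t. J (t, y t))"
    and "AE t in lebesgue_on {0..T}. \<exists>r. ((\<lambda>t. J (t, y t)) has_real_derivative r) (at t within {0..T}) \<and>
      t \<in> {0<..<T} \<and> (t, y t) \<in> G \<and>
      has_dir_deriv J (t, y t) (1, f t (y t) (v t)) r \<and> has_dir_deriv J (t, y t) (- (1, f t (y t) (v t))) (- r)"
proof -
  define \<phi> where "\<phi> t = J (t, y t)" for t
  have "absolutely_continuous_on {0..T} \<phi>"
  proof (rule absolutely_continuous_on_dominated[OF trajectory_absolutely_continuous[OF y] K_nonneg K_nonneg])
    fix s t assume st: "s \<in> {0..T}" "t \<in> {0..T}"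
    have "norm (\<phi> t - \<phi> s) \<le> K * dist (t, y t) (s, y s)"
      using lipschitz_onD[OF lipschitz_J, of "(t, y t)" "(s, y s)"] st by (simp add: \<phi>_def dist_norm)
    also have "\<dots> \<le> K * (\<bar>t - s\<bar> + norm (y t - y s))"
      using norm_Pair_le[of "t - s" "y t - y s"] K_nonneg by (intro mult_left_mono) (auto simp: dist_norm)
    finally show "norm (\<phi> t - \<phi> s) \<le> K * \<bar>t - s\<bar> + K * norm (y t - y s)" by (simp add: algebra_simps)
  qed
  then show "absolutely_continuous_on {0..T} (\<lambda>t. J (t, y t))" by (simp add: \<phi>_def[abs_def])
  obtain N where N: "negligible N"
    "\<forall>t\<in>{0..T} - N. (y has_vector_derivative f t (y t) (v t)) (at t within {0..T})"
    by (rule trajectory_derivative[OF y])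
  define C where "C = {t. \<exists>r l. has_dir_deriv \<phi> t 1 r \<and> has_dir_deriv \<phi> t (-1) l \<and> r \<noteq> - l}"
  have "negligible C" unfolding C_def
    using countable_imp_null_set_lborel[OF countable_one_sided_derivs_differ]
    by (simp add: negligible_iff_null_sets null_sets_completionI)
  then have neg: "negligible (N \<union> C \<union> {0, T})" using N by (intro negligible_Un) auto
  have main: "\<exists>r. (\<phi> has_real_derivative r) (at t within {0..T}) \<and> t \<in> {0<..<T} \<and> (t, y t) \<in> G \<and>
      has_dir_deriv J (t, y t) (1, f t (y t) (v t)) r \<and> has_dir_deriv J (t, y t) (- (1, f t (y t) (v t))) (- r)"
    if t: "t \<in> {0..T} - (N \<union> C \<union> {0, T})" for t
  proof -
    define w where "w = (1::real, f t (y t) (v t))"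
    have t0: "t \<in> {0<..<T}" using t by auto
    have "(y has_vector_derivative f t (y t) (v t)) (at t)"
      using N(2)[rule_format, of t] t t0 at_within_Icc_at[of 0 t T] by simp
    then have curve: "((\<lambda>s. (s, y s)) has_vector_derivative w) (at t)"
      unfolding has_vector_derivative_def w_def
      by (auto intro!: derivative_eq_intros)
    obtain r where r: "has_dir_deriv J (t, y t) w r" using has_dir_deriv_ex[OF t0] by blast
    obtain l where l: "has_dir_deriv J (t, y t) (- w) l" using has_dir_deriv_ex[OF t0] by blast
    have "has_dir_deriv \<phi> t 1 r" "has_dir_deriv \<phi> t (-1) l"
      unfolding \<phi>_def[abs_def]
      using t0 r l by (auto intro!: has_dir_deriv_along_curve[OF lipschitz_strip open_strip _ curve])
    moreover from this have "l = - r" using t by (auto simp: C_def)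
    ultimately have "(\<phi> has_real_derivative r) (at t)"
      using has_real_derivative_if_dir_derivs by blast
    then have "(\<phi> has_real_derivative r) (at t within {0..T})" by (rule has_field_derivative_at_within)
    moreover have "(t, y t) \<in> G" using t0 ball by auto
    ultimately show ?thesis using t0 r l \<open>l = - r\<close> by (auto simp: w_def)
  qed
  have "AE t in lebesgue_on {0..T}. \<exists>r. (\<phi> has_real_derivative r) (at t within {0..T}) \<and>
      t \<in> {0<..<T} \<and> (t, y t) \<in> G \<and>
      has_dir_deriv J (t, y t) (1, f t (y t) (v t)) r \<and> has_dir_deriv J (t, y t) (- (1, f t (y t) (v t))) (- r)"
    by (rule AE_lebesgue_on_iff_negligible[THEN iffD2])
      (simp, intro exI[of _ "N \<union> C \<union> {0, T}"] conjI neg ballI main)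
  then show "AE t in lebesgue_on {0..T}. \<exists>r. ((\<lambda>t. J (t, y t)) has_real_derivative r) (at t within {0..T}) \<and>
      t \<in> {0<..<T} \<and> (t, y t) \<in> G \<and>
      has_dir_deriv J (t, y t) (1, f t (y t) (v t)) r \<and> has_dir_deriv J (t, y t) (- (1, f t (y t) (v t))) (- r)"
    unfolding \<phi>_def[abs_def] .
qed

lemma running_cost_has_integral:
  assumes "trajectory_of v x\<^sub>0 y"
  shows "((\<lambda>t. c t (y t) (v t)) has_integral (LINT t|lebesgue_on {0..T}. c t (y t) (v t))) {0..T}"
  using has_integral_integral_lebesgue_on[OF integrable_running_cost[OF assms]] by simp

lemma cost_lower_bound:
  assumes y: "trajectory_of v x\<^sub>0 y" and ball: "\<forall>t\<in>{0..<T}. y t \<in> ball 0 R"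
  shows "J (0, x\<^sub>0) - T * D\<^sub>1 \<le> (LINT t|lebesgue_on {0..T}. c t (y t) (v t)) + J (T, y T)"
proof -
  have int: "((\<lambda>t. - D\<^sub>1 - c t (y t) (v t)) has_integral (T * (- D\<^sub>1) - (LINT t|lebesgue_on {0..T}. c t (y t) (v t)))) {0..T}"
    using has_integral_diff[OF has_integral_const_real[of "- D\<^sub>1" 0 T] running_cost_has_integral[OF y]] T_pos
    by simp
  have "T * (- D\<^sub>1) - (LINT t|lebesgue_on {0..T}. c t (y t) (v t)) \<le> J (T, y T) - J (0, y 0)"
  proof (rule absolutely_continuous_increment_ge[OF _ candidate_along_trajectory(1)[OF y ball] int])
    show "AE t in lebesgue_on {0..T}. \<exists>D. ((\<lambda>t. J (t, y t)) has_real_derivative D) (at t within {0..T}) \<and>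
        - D\<^sub>1 - c t (y t) (v t) \<le> D"
      using candidate_along_trajectory(2)[OF y ball]
    proof eventually_elim
      case (elim t)
      then obtain r where r: "((\<lambda>t. J (t, y t)) has_real_derivative r) (at t within {0..T})" "t \<in> {0<..<T}"
        "(t, y t) \<in> G" "has_dir_deriv J (t, y t) (1, f t (y t) (v t)) r" by blast
      have "v t \<in> U" using r(2) trajectory_input[OF y] by simp
      then show ?case using dir_deriv_lower_bound[OF r(3) _ r(4)] r(1) by blast
    qed
  qed (use T_pos in auto)
  then show ?thesis by (simp add: trajectory_start[OF y] algebra_simps)
qed

text \<open>
  The derivative of \<open>- J (t, y t)\<close> is bounded below, so that \<open>absolutely_continuous_increment_ge\<close> applies.
\<close>

lemma cost_upper_bound:
  assumes y: "trajectory_of v x\<^sub>0 y" and ball: "\<forall>t\<in>{0..<T}. y t \<in> ball 0 R"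
    and v: "\<And>t. t \<in> {0..T} \<Longrightarrow> v t = \<pi> (t, y t)"
    and min: "\<And>t x. t \<in> {0<..<T} \<Longrightarrow> is_arg_min (\<lambda>(p, q, u). p + hamiltonian c f t x u q)
      (\<lambda>(p, q, u). (p, q) \<in> bidifferential \<Omega> J (t, x) \<and> u \<in> U) (p\<^sub>J (t, x), q\<^sub>J (t, x), \<pi> (t, x))"
  shows "(LINT t|lebesgue_on {0..T}. c t (y t) (v t)) + J (T, y T) \<le> J (0, x\<^sub>0) + T * D\<^sub>1"
proof -
  have ac: "absolutely_continuous_on {0..T} (\<lambda>t. - J (t, y t))"
    by (rule absolutely_continuous_on_dominated[OF candidate_along_trajectory(1)[OF y ball], of 0 1]) auto
  have int: "((\<lambda>t. - D\<^sub>1 + c t (y t) (v t)) has_integral (T * (- D\<^sub>1) + (LINT t|lebesgue_on {0..T}. c t (y t) (v t)))) {0..T}"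
    using has_integral_add[OF has_integral_const_real[of "- D\<^sub>1" 0 T] running_cost_has_integral[OF y]] T_pos
    by simp
  have "T * (- D\<^sub>1) + (LINT t|lebesgue_on {0..T}. c t (y t) (v t)) \<le> - J (T, y T) - (- J (0, y 0))"
  proof (rule absolutely_continuous_increment_ge[OF _ ac int])
    show "AE t in lebesgue_on {0..T}. \<exists>D. ((\<lambda>t. - J (t, y t)) has_real_derivative D) (at t within {0..T}) \<and>
        - D\<^sub>1 + c t (y t) (v t) \<le> D"
      using candidate_along_trajectory(2)[OF y ball]
    proof eventually_elim
      case (elim t)
      then obtain r where r: "((\<lambda>t. J (t, y t)) has_real_derivative r) (at t within {0..T})" "t \<in> {0<..<T}"
        "(t, y t) \<in> G" "has_dir_deriv J (t, y t) (1, f t (y t) (v t)) r"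
        "has_dir_deriv J (t, y t) (- (1, f t (y t) (v t))) (- r)" by blast
      have "v t \<in> U" using r(2) trajectory_input[OF y] by simp
      moreover have "\<pi> (t, y t) = v t" using v[of t] r(2) by simp
      ultimately have "r \<le> D\<^sub>1 - c t (y t) (v t)"
        using dir_deriv_upper_bound[OF r(3) _ _ r(4,5)] min[OF r(2), of "y t"] by simp
      then show ?case using r(1) by (intro exI[of _ "- r"]) (auto intro: DERIV_minus)
    qed
  qed (use T_pos in auto)
  then show ?thesis by (simp add: trajectory_start[OF y] algebra_simps)
qed

end

section \<open>The performance bound\<close>

lemma solves_ivp_trajectory:
  "solves_ivp F 0 T x\<^sub>0 x \<Longrightarrow> solves_ivp F 0 T x\<^sub>0 (trajectory F T x\<^sub>0)"
  unfolding trajectory_def by (rule someI[where P = "solves_ivp F 0 T x\<^sub>0"])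

text \<open>
  If a residual is infinite, so is the right-hand side, because both residuals are nonnegative; otherwise the two
  cost bounds apply with the residuals as real numbers.
\<close>

theorem proposition1:
  fixes c :: "real \<Rightarrow> real^'n \<Rightarrow> real^'m \<Rightarrow> real"
    and g :: "real^'n \<Rightarrow> real"
    and f :: "real \<Rightarrow> real^'n \<Rightarrow> real^'m \<Rightarrow> real^'n"
    and U :: "(real^'m) set"
    and T \<beta>\<^sub>f R :: real
    and J :: "real \<times> (real^'n) \<Rightarrow> real"
    and \<pi>\<^sub>J :: "real \<times> (real^'n) \<Rightarrow> real^'m"
    and x\<^sub>0 :: "real^'n"
    and \<delta>\<^sub>1 \<delta>\<^sub>2 :: ereal
  assumes "class_L c g f U T \<beta>\<^sub>f"
    and "admissible_candidate c f U T J"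
    and "associated_controller c f U T J \<pi>\<^sub>J"
    and "R = (1 + norm x\<^sub>0) * exp (\<beta>\<^sub>f * T) - 1"
    and "\<delta>\<^sub>1 = esssup (lebesgue_on ({0..T} \<times> ball 0 R)) (\<lambda>(t, x). ereal \<bar>hjb_residual c f U J t x\<bar>)"
    and "\<delta>\<^sub>2 = esssup (lebesgue_on (ball 0 R)) (\<lambda>x. ereal \<bar>J (T, x) - g x\<bar>)"
  shows "ereal (optimality_gap c g f U T (controller_input f T \<pi>\<^sub>J x\<^sub>0) x\<^sub>0) \<le> ereal (2 * T) * \<delta>\<^sub>1 + 2 * \<delta>\<^sub>2"
proof -
  interpret class_L_problem c g f U T \<beta>\<^sub>f by unfold_locales (rule assms(1))
  have "exp (\<beta>\<^sub>f * T) > 1" using beta_pos T_pos by simp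
  moreover have "1 * exp (\<beta>\<^sub>f * T) \<le> (1 + norm x\<^sub>0) * exp (\<beta>\<^sub>f * T)" by (intro mult_right_mono) auto
  ultimately have R_pos: "R > 0" using assms(4) by linarith
  have ae1: "AE z in lborel. z \<in> {0..T} \<times> ball 0 R \<longrightarrow> ereal \<bar>hjb_residual c f U J (fst z) (snd z)\<bar> \<le> \<delta>\<^sub>1"
  proof -
    have "{0..T} \<times> (ball 0 R :: (real^'n) set) \<in> sets lebesgue"
      by (intro sets_completionI_sets) (simp add: borel_Times)
    moreover have "AE z in lebesgue_on ({0..T} \<times> ball 0 R). ereal \<bar>hjb_residual c f U J (fst z) (snd z)\<bar> \<le> \<delta>\<^sub>1"
      using esssup_AE[of "\<lambda>(t, x). ereal \<bar>hjb_residual c f U J t x\<bar>" "lebesgue_on ({0..T} \<times> ball 0 R)"]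
      unfolding assms(5) by (simp add: case_prod_unfold)
    ultimately have "AE z in lebesgue. z \<in> {0..T} \<times> ball 0 R \<longrightarrow> ereal \<bar>hjb_residual c f U J (fst z) (snd z)\<bar> \<le> \<delta>\<^sub>1"
      by (subst (asm) AE_restrict_space_iff) auto
    then show ?thesis by (simp only: AE_completion_iff)
  qed
  have ae2: "AE x in lborel. x \<in> ball 0 R \<longrightarrow> ereal \<bar>J (T, x) - g x\<bar> \<le> \<delta>\<^sub>2"
  proof -
    have "AE x in lebesgue_on (ball 0 R). ereal \<bar>J (T, x) - g x\<bar> \<le> \<delta>\<^sub>2"
      unfolding assms(6) by (rule esssup_AE)
    then have "AE x in lebesgue. x \<in> ball 0 R \<longrightarrow> ereal \<bar>J (T, x) - g x\<bar> \<le> \<delta>\<^sub>2"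
      by (subst (asm) AE_restrict_space_iff) auto
    then show ?thesis by (simp only: AE_completion_iff)
  qed
  have nonneg1: "0 \<le> \<delta>\<^sub>1"
  proof -
    have "AE z in lborel. z \<in> {0<..<T} \<times> ball 0 R \<longrightarrow> ereal \<bar>hjb_residual c f U J (fst z) (snd z)\<bar> \<le> \<delta>\<^sub>1"
      using ae1 by eventually_elim auto
    then obtain z where "ereal \<bar>hjb_residual c f U J (fst z) (snd z)\<bar> \<le> \<delta>\<^sub>1"
      by (rule AE_lborel_imp_ex_in_open[of _ _ "(T / 2, 0)"]) (use T_pos R_pos in \<open>auto intro: open_Times\<close>)
    then show ?thesis by (rule order_trans[rotated]) simp
  qed
  have nonneg2: "0 \<le> \<delta>\<^sub>2"
  proof -
    obtain x where "ereal \<bar>J (T, x) - g x\<bar> \<le> \<delta>\<^sub>2"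
      by (rule AE_lborel_imp_ex_in_open[OF ae2, of 0]) (use R_pos in auto)
    then show ?thesis by (rule order_trans[rotated]) simp
  qed
  show ?thesis
  proof (cases "\<delta>\<^sub>1 = \<infinity> \<or> \<delta>\<^sub>2 = \<infinity>")
    case True
    then have "ereal (2 * T) * \<delta>\<^sub>1 + 2 * \<delta>\<^sub>2 = \<infinity>"
      using nonneg1 nonneg2 T_pos by (cases \<delta>\<^sub>1; cases \<delta>\<^sub>2) auto
    then show ?thesis by (simp only: ereal_less_eq)
  next
    case False
    obtain D\<^sub>1 where D1: "\<delta>\<^sub>1 = ereal D\<^sub>1" using False nonneg1 by (cases \<delta>\<^sub>1) auto
    obtain D\<^sub>2 where D2: "\<delta>\<^sub>2 = ereal D\<^sub>2" using False nonneg2 by (cases \<delta>\<^sub>2) auto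
    obtain K where K: "K-lipschitz_on ({0..T} \<times> UNIV) J"
      using assms(2) unfolding admissible_candidate_def by blast
    interpret hjb_candidate c g f U T \<beta>\<^sub>f J K D\<^sub>1 R
    proof
      show "bidifferential ({0..T} \<times> UNIV) J (t, x) = clarke_gradient J (t, x)" if "t \<in> {0<..<T}" for t x
        using assms(2) that unfolding admissible_candidate_def by blast
      show "AE z in lborel. z \<in> {0<..<T} \<times> ball 0 R \<longrightarrow> \<bar>hjb_residual c f U J (fst z) (snd z)\<bar> \<le> D\<^sub>1"
        using ae1 by eventually_elim (auto simp: D1)
    qed (rule K)
    \<comment> \<open>A trajectory may end on the sphere of radius \<open>R\<close>; continuity extends the essential bound to the closed ball.\<close>
    have terminal: "\<bar>J (T, x) - g x\<bar> \<le> D\<^sub>2" if "x \<in> cball 0 R" for x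
    proof -
      define C where "C = {x. \<bar>J (T, x) - g x\<bar> \<le> D\<^sub>2}"
      have "continuous_on UNIV (\<lambda>x. J (T, x))"
        by (rule continuous_on_compose2[OF lipschitz_on_continuous_on[OF K]])
          (use T_pos in \<open>auto intro!: continuous_intros\<close>)
      then have "closed C" unfolding C_def
        by (intro closed_Collect_le continuous_intros continuous_on_g)
      have "AE x\<in>ball 0 R in lborel. x \<in> C" using ae2 by eventually_elim (simp add: C_def D2)
      then have "AE x\<in>ball 0 R in lebesgue. x \<in> C" by (rule AE_completion)
      from mem_closed_if_AE_lebesgue_open[OF open_ball \<open>closed C\<close> this]
      have "ball 0 R \<subseteq> C" by blast
      then have "closure (ball 0 R) \<subseteq> C" using \<open>closed C\<close> by (rule closure_minimal)
      then show ?thesis using that R_pos by (auto simp: C_def)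
    qed
    have in_ball: "\<forall>t\<in>{0..<T}. y t \<in> ball 0 R" if y: "trajectory_of v x\<^sub>0 y" for v y
    proof
      fix t assume t: "t \<in> {0..<T}"
      have "1 + norm (y t) \<le> (1 + norm x\<^sub>0) * exp (\<beta>\<^sub>f * t)" using trajectory_growth[OF y] t by simp
      also have "\<dots> < (1 + norm x\<^sub>0) * exp (\<beta>\<^sub>f * T)"
        using t beta_pos by (intro mult_strict_left_mono) (auto simp: add_pos_nonneg)
      finally show "y t \<in> ball 0 R" using assms(4) by simp
    qed
    have end_cball: "y T \<in> cball 0 R" if y: "trajectory_of v x\<^sub>0 y" for v y
      using trajectory_growth[OF y, of T] T_pos assms(4) by simp
    have lower: "J (0, x\<^sub>0) - T * D\<^sub>1 - D\<^sub>2 \<le> total_cost c g 0 T y v" if y: "trajectory_of v x\<^sub>0 y" for v y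
      using cost_lower_bound[OF y in_ball[OF y]] terminal[OF end_cball[OF y]] unfolding total_cost_def by linarith
    obtain p\<^sub>J q\<^sub>J where min: "\<forall>t\<in>{0<..<T}. \<forall>x. is_arg_min (\<lambda>(p, q, u). p + hamiltonian c f t x u q)
        (\<lambda>(p, q, u). (p, q) \<in> bidifferential \<Omega> J (t, x) \<and> u \<in> U) (p\<^sub>J (t, x), q\<^sub>J (t, x), \<pi>\<^sub>J (t, x))"
      using assms(3) unfolding associated_controller_def by blast
    \<comment> \<open>The closed loop \<open>z\<close> defines the input \<open>u\<close>, while the cost of \<open>u\<close> is that of a chosen open-loop solution \<open>y\<close>. The two
      agree on \<open>[0, T]\<close> by uniqueness.\<close>
    define z where "z = trajectory (\<lambda>t z. f t z (\<pi>\<^sub>J (t, z))) T x\<^sub>0"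
    define u where "u = controller_input f T \<pi>\<^sub>J x\<^sub>0"
    have u_eq: "u t = \<pi>\<^sub>J (t, z t)" for t by (simp add: u_def z_def controller_input_def)
    have z: "trajectory_of u x\<^sub>0 z"
    proof -
      have "0 \<in> {0..T}" using T_pos by simp
      then obtain x where x: "solves_ivp (\<lambda>t z. f t z (\<pi>\<^sub>J (t, z))) 0 T x\<^sub>0 x"
        "\<forall>y. solves_ivp (\<lambda>t z. f t z (\<pi>\<^sub>J (t, z))) 0 T x\<^sub>0 y \<longrightarrow> (\<forall>t\<in>{0..T}. y t = x t)"
        "admissible_input U 0 T (\<lambda>t. \<pi>\<^sub>J (t, x t))"
        using assms(3) unfolding associated_controller_def admissible_controller_def by blast
      have sol: "solves_ivp (\<lambda>t z. f t z (\<pi>\<^sub>J (t, z))) 0 T x\<^sub>0 z"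
        unfolding z_def using x(1) by (rule solves_ivp_trajectory)
      then have eq: "z t = x t" if "t \<in> {0..T}" for t using x(2) that by blast
      have "admissible_input U 0 T u"
        unfolding admissible_input_def
      proof
        have "(\<lambda>t. \<pi>\<^sub>J (t, x t)) \<in> borel_measurable (lebesgue_on {0..T})"
          using x(3) by (simp add: admissible_input_def)
        then show "u \<in> borel_measurable (lebesgue_on {0..T})"
          by (rule measurable_cong[THEN iffD1, rotated]) (simp add: u_eq eq space_restrict_space)
        show "\<forall>t\<in>{0..T}. u t \<in> U" using x(3) by (simp add: u_eq eq admissible_input_def)
      qed
      moreover have "solves_ivp (\<lambda>t z. f t z (u t)) 0 T x\<^sub>0 z"
        using sol by (simp add: solves_ivp_def u_eq)
      ultimately show ?thesis by (simp add: trajectory_of_def)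
    qed
    define y where "y = trajectory (\<lambda>t z. f t z (u t)) T x\<^sub>0"
    have y: "trajectory_of u x\<^sub>0 y"
    proof -
      have "solves_ivp (\<lambda>t z. f t z (u t)) 0 T x\<^sub>0 y"
        using z unfolding y_def trajectory_of_def by (intro solves_ivp_trajectory[of _ _ _ z]) blast
      then show ?thesis using z by (simp add: trajectory_of_def)
    qed
    have "u t = \<pi>\<^sub>J (t, y t)" if "t \<in> {0..T}" for t
      using trajectory_unique[OF y z that] by (simp add: u_eq)
    then have upper: "total_cost c g 0 T y u \<le> J (0, x\<^sub>0) + T * D\<^sub>1 + D\<^sub>2"
      using cost_upper_bound[OF y in_ball[OF y], of \<pi>\<^sub>J p\<^sub>J q\<^sub>J] min terminal[OF end_cball[OF y]]
      unfolding total_cost_def by fastforce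
    have "J (0, x\<^sub>0) - T * D\<^sub>1 - D\<^sub>2 \<le> value_function c g f U T 0 x\<^sub>0"
      unfolding value_function_def
    proof (rule cInf_greatest)
      show "{total_cost c g 0 T x u | u x.
            admissible_input U 0 T u \<and> solves_ivp (\<lambda>t z. f t z (u t)) 0 T x\<^sub>0 x} \<noteq> {}"
        using y unfolding trajectory_of_def by blast
    qed (use lower in \<open>auto simp: trajectory_of_def\<close>)
    then have "optimality_gap c g f U T u x\<^sub>0 \<le> 2 * T * D\<^sub>1 + 2 * D\<^sub>2"
      using upper unfolding optimality_gap_def y_def by simp
    then show ?thesis by (simp add: D1 D2 u_def)
  qed
qed

end
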